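(* Let $p$ be a prime and $e$ a positive integer with $e\mid p-1$ and $e\le (p-1)/2$. Given two oracles $\mathcal{O}_{e,s}$ and $\mathcal{O}_{e,t}$ for some unknown $s,t\in\mathbb{F}_p$, there is a deterministic algorithm which decides whether $s=t$ in time $\max\{e^{1/2}p^{o(1)},\, e^{2}p^{-1+o(1)}\}$ as $p\to\infty$.
   Context: For a prime $p$, a positive integer $e\mid p-1$ and a hidden element $s\in\mathbb{F}_p$, the oracle $\mathcal{O}_{e,s}$ is a black box which, on any input $x\in\mathbb{F}_p$, returns $(x+s)^e\in\mathbb{F}_p$. Running time counts bit operations, each oracle call having unit cost. *)

theory Defs
  imports "HOL-Computational_Algebra.Primes" Complex_Main
begin

text \<open>A deterministic logarithmic-cost random access machine with access to two
query functions.  Memory is a map from integer addresses to integers; instruction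
operands are fixed addresses, Load/Store provide indirect addressing.
Cost of arithmetic is measured in bit operations; an power_box call costs 1.\<close>

datatype instr =
    Const int int
  | Add int int int
  | Sub int int int
  | Mul int int int
  | Div int int int
  | Mod int int int
  | Load int int
  | Store int int
  | Jz int nat
  | Jneg int nat
  | Query1 int int
  | Query2 int int
  | Halt int

datatype state = Running nat "int \<Rightarrow> int" | Halted bool

definition bitlen :: "int \<Rightarrow> nat" where
  "bitlen x = nat \<lceil>log 2 (real_of_int \<bar>x\<bar> + 1)\<rceil> + 1"

definition step :: "instr list \<Rightarrow> (int \<Rightarrow> int) \<Rightarrow> (int \<Rightarrow> int) \<Rightarrow> nat \<Rightarrow> (int \<Rightarrow> int)
    \<Rightarrow> state \<times> nat" where
  "step P f g pc m =
    (if length P \<le> pc then (Halted False, 1) else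
     (case P ! pc of
        Const r c \<Rightarrow> (Running (Suc pc) (m(r := c)), bitlen c)
      | Add r a b \<Rightarrow> (Running (Suc pc) (m(r := m a + m b)), bitlen (m a) + bitlen (m b))
      | Sub r a b \<Rightarrow> (Running (Suc pc) (m(r := m a - m b)), bitlen (m a) + bitlen (m b))
      | Mul r a b \<Rightarrow> (Running (Suc pc) (m(r := m a * m b)), bitlen (m a) * bitlen (m b))
      | Div r a b \<Rightarrow> (Running (Suc pc) (m(r := m a div m b)), bitlen (m a) * bitlen (m b))
      | Mod r a b \<Rightarrow> (Running (Suc pc) (m(r := m a mod m b)), bitlen (m a) * bitlen (m b))
      | Load r a \<Rightarrow> (Running (Suc pc) (m(r := m (m a))), bitlen (m a) + bitlen (m (m a)))
      | Store r a \<Rightarrow> (Running (Suc pc) (m(m a := m r)), bitlen (m a) + bitlen (m r))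
      | Jz r t \<Rightarrow> (Running (if m r = 0 then t else Suc pc) m, 1)
      | Jneg r t \<Rightarrow> (Running (if m r < 0 then t else Suc pc) m, 1)
      | Query1 r a \<Rightarrow> (Running (Suc pc) (m(r := f (m a))), 1)
      | Query2 r a \<Rightarrow> (Running (Suc pc) (m(r := g (m a))), 1)
      | Halt r \<Rightarrow> (Halted (m r \<noteq> 0), 1)))"

fun exec :: "instr list \<Rightarrow> (int \<Rightarrow> int) \<Rightarrow> (int \<Rightarrow> int) \<Rightarrow> nat \<Rightarrow> state \<Rightarrow> nat
    \<Rightarrow> state \<times> nat" where
  "exec P f g 0 st c = (st, c)"
| "exec P f g (Suc n) (Halted b) c = (Halted b, c)"
| "exec P f g (Suc n) (Running pc m) c =
     (case step P f g pc m of (st', d) \<Rightarrow> exec P f g n st' (c + d))"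

definition outputs_within ::
  "instr list \<Rightarrow> (int \<Rightarrow> int) \<Rightarrow> (int \<Rightarrow> int) \<Rightarrow> (int \<Rightarrow> int) \<Rightarrow> bool \<Rightarrow> real \<Rightarrow> bool" where
  "outputs_within P f g m0 b T \<longleftrightarrow>
     (\<exists>n c. exec P f g n (Running 0 m0) 0 = (Halted b, c) \<and> real c \<le> T)"

text \<open>Elements of F_p are represented by integers; the power_box O_{e,s}
returns the canonical representative of (x+s)^e in {0..p-1}.\<close>
definition power_box :: "nat \<Rightarrow> nat \<Rightarrow> nat \<Rightarrow> int \<Rightarrow> int" where
  "power_box p e s x = (x + int s) ^ e mod int p"

definition init_mem :: "nat \<Rightarrow> nat \<Rightarrow> int \<Rightarrow> int" where
  "init_mem p e = (\<lambda>_. 0)(0 := int p, 1 := int e)"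

end

theory Submission
  imports Defs "HOL-Number_Theory.Residues" "HOL-Analysis.Kronecker_Approximation_Theorem"
    "HOL-Library.Log_Nat" "HOL-Real_Asymp.Real_Asymp"
begin

text \<open>
  The program queries both boxes at \<open>x = 0, 1, 2, \<dots>\<close> until the answers differ or \<open>x\<close> reaches a
  bound \<open>h\<close>. Suppose \<open>s \<noteq> t\<close> and all answers agree for \<open>x < h\<close>. Then every
  \<open>z\<^sub>x = (x + s) / (x + t)\<close> is an \<open>e\<close>-th root of unity, and so are the \<open>h\<^sup>2\<close> products \<open>z\<^sub>x z\<^sub>y\<close>, which
  therefore take at most \<open>e\<close> values. For \<open>l \<noteq> 1\<close> the equation \<open>z\<^sub>x z\<^sub>y = l\<close> describes a modular
  hyperbola \<open>(x - a) (y - a) = c\<close>, and such a hyperbola has at most \<open>(h\<^sup>3 / p)\<^sup>1\<^sup>/\<^sup>2 + 1\<close> points in the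
  box, up to a factor \<open>p\<^sup>o\<^sup>(\<^sup>1\<^sup>)\<close> (an argument of Cilleruelo and Garaev): by Dirichlet some small
  multiple \<open>q a\<close> is close to a multiple of \<open>p\<close>, which turns the congruence into few integer
  equations \<open>(q x - r) (q y - r) = n\<close>, each with few solutions by the divisor bound.
  Hence \<open>h\<close> is at most the maximum of \<open>e\<^sup>1\<^sup>/\<^sup>2\<close> and \<open>e\<^sup>2 / p\<close>, up to a factor \<open>p\<^sup>o\<^sup>(\<^sup>1\<^sup>)\<close>.
\<close>

section \<open>Products of shifted ratios and modular hyperbolas\<close>

lemma card_divisors_le_prod:
  fixes n :: nat
  assumes "n > 0"
  shows "card {d. d dvd n} \<le> (\<Prod>q\<in>prime_factors n. multiplicity q n + 1)"
proof -
  let ?F = "\<lambda>d. restrict (\<lambda>q. multiplicity q d) (prime_factors n)"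
  \<comment> \<open>A divisor is determined by its exponents at the primes of \<open>n\<close>, so
    the divisors inject into a box of exponent vectors.\<close>
  have "inj_on ?F {d. d dvd n}"
  proof (rule inj_onI)
    fix a b assume ab: "a \<in> {d. d dvd n}" "b \<in> {d. d dvd n}" and eq: "?F a = ?F b"
    have pos: "a > 0" "b > 0" using ab assms by (auto intro: Nat.gr0I)
    show "a = b"
    proof (rule multiplicity_eq_nat[OF pos])
      fix q :: nat assume q: "prime q"
      show "multiplicity q a = multiplicity q b"
      proof (cases "q \<in> prime_factors n")
        case True
        then show ?thesis using fun_cong[OF eq, of q] by simp
      next
        case False
        then have "\<not> q dvd n" using q assms by (auto simp: prime_factors_dvd)
        then have "\<not> q dvd a" "\<not> q dvd b" using ab by (auto dest: dvd_trans)
        then show ?thesis by (simp add: not_dvd_imp_multiplicity_0)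
      qed
    qed
  qed
  moreover have "?F ` {d. d dvd n} \<subseteq> (\<Pi>\<^sub>E q\<in>prime_factors n. {..multiplicity q n})"
    using assms by (auto simp: PiE_iff intro!: dvd_imp_multiplicity_le)
  ultimately have "card {d. d dvd n} \<le> card (\<Pi>\<^sub>E q\<in>prime_factors n. {..multiplicity q n})"
    by (intro card_inj_on_le[of ?F]) (auto intro!: finite_PiE)
  then show ?thesis by (simp add: card_PiE)
qed

text \<open>Primes below \<open>2\<^sup>j\<close> contribute few factors \<open>multiplicity + 1\<close>, each at most \<open>N\<close>; the larger primes
  occur at most \<open>N / j\<close> times altogether. With \<open>2\<^sup>j\<close> close to the square root of \<open>N\<close> this is \<open>2\<^sup>o\<^sup>(\<^sup>N\<^sup>)\<close>.\<close>

lemma card_divisors_le: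
  fixes n N j :: nat
  assumes "n > 0" "n < 2 ^ N" "j > 0"
  shows "card {d. d dvd n} \<le> N ^ (2 ^ j) * 2 ^ (N div j)"
proof -
  define S where "S = {q \<in> prime_factors n. q < 2 ^ j}"
  define B where "B = {q \<in> prime_factors n. 2 ^ j \<le> q}"
  have fin: "finite S" "finite B" and split: "prime_factors n = S \<union> B" "S \<inter> B = {}"
    by (auto simp: S_def B_def)
  have pw: "q ^ multiplicity q n \<le> n" for q
    using assms(1) by (simp add: dvd_imp_le multiplicity_dvd)
  have "N > 0" using assms(1,2) by (cases N) auto
  have m: "multiplicity q n + 1 \<le> N" if "q \<in> S" for q
  proof -
    have "2 \<le> q" using that by (auto simp: S_def intro: prime_ge_2_nat)
    then have "(2::nat) ^ multiplicity q n \<le> q ^ multiplicity q n" by (rule power_mono) simp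
    also have "\<dots> < 2 ^ N" using pw assms(2) by (rule le_less_trans)
    finally show ?thesis by simp
  qed
  have cS: "card S \<le> 2 ^ j"
    using card_mono[of "{..<2 ^ j}" S] by (auto simp: S_def)
  have "(\<Prod>q\<in>S. multiplicity q n + 1) \<le> (\<Prod>q\<in>S. N)"
    using m by (intro prod_mono) auto
  also have "\<dots> \<le> N ^ (2 ^ j)"
    using cS \<open>N > 0\<close> by (simp add: power_increasing)
  finally have 1: "(\<Prod>q\<in>S. multiplicity q n + 1) \<le> N ^ (2 ^ j)" .
  have "2 ^ (j * (\<Sum>q\<in>B. multiplicity q n)) = (\<Prod>q\<in>B. (2 ^ j) ^ multiplicity q n :: nat)"
    by (simp add: power_sum power_mult)
  also have "\<dots> \<le> (\<Prod>q\<in>B. q ^ multiplicity q n)"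
    by (intro prod_mono) (auto simp: B_def intro: power_mono)
  also have "\<dots> \<le> (\<Prod>q\<in>prime_factors n. q ^ multiplicity q n)"
    by (intro dvd_imp_le prod_dvd_prod_subset) (auto simp: B_def prime_factors_dvd intro!: prod_pos prime_gt_0_nat)
  also have "\<dots> = n" using assms(1) by (simp add: prod_prime_factors)
  also note assms(2)
  finally have "j * (\<Sum>q\<in>B. multiplicity q n) < N" by simp
  then have le: "(\<Sum>q\<in>B. multiplicity q n) \<le> N div j"
    using assms(3) by (simp add: less_eq_div_iff_mult_less_eq mult.commute)
  have "(\<Prod>q\<in>B. multiplicity q n + 1) \<le> (\<Prod>q\<in>B. 2 ^ multiplicity q n)"
    by (intro prod_mono) (auto simp: Suc_leI)
  also have "\<dots> \<le> 2 ^ (N div j)"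
    using le by (simp flip: power_sum)
  finally have 2: "(\<Prod>q\<in>B. multiplicity q n + 1) \<le> 2 ^ (N div j)" .
  have "card {d. d dvd n} \<le> (\<Prod>q\<in>S. multiplicity q n + 1) * (\<Prod>q\<in>B. multiplicity q n + 1)"
    using card_divisors_le_prod[OF assms(1)] fin split by (simp add: prod.union_disjoint)
  also have "\<dots> \<le> N ^ (2 ^ j) * 2 ^ (N div j)" using 1 2 by (rule mult_le_mono)
  finally show ?thesis .
qed

lemma card_int_divisors_le:
  fixes n :: int and N j :: nat
  assumes "n \<noteq> 0" "\<bar>n\<bar> < 2 ^ N" "j > 0"
  shows "finite {d. d dvd n}" "card {d. d dvd n} \<le> 2 * (N ^ (2 ^ j) * 2 ^ (N div j))"
proof -
  let ?A = "{d. d dvd nat \<bar>n\<bar>}"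
  have fin: "finite ?A" using assms(1) by (intro finite_divisors_nat) simp
  have sub: "{d. d dvd n} \<subseteq> int ` ?A \<union> (\<lambda>d. - int d) ` ?A"
  proof
    fix d assume "d \<in> {d. d dvd n}"
    then have "nat \<bar>d\<bar> \<in> ?A" by (simp add: nat_abs_dvd_iff)
    moreover have "d = int (nat \<bar>d\<bar>) \<or> d = - int (nat \<bar>d\<bar>)" by linarith
    ultimately show "d \<in> int ` ?A \<union> (\<lambda>d. - int d) ` ?A" by blast
  qed
  show "finite {d. d dvd n}" using finite_subset[OF sub] fin by blast
  have "card {d. d dvd n} \<le> card (int ` ?A \<union> (\<lambda>d. - int d) ` ?A)"
    using sub fin by (intro card_mono) auto
  also have "\<dots> \<le> card ?A + card ?A"
    by (rule order_trans[OF card_Un_le]) (intro add_mono card_image_le fin)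
  also have "card ?A \<le> N ^ (2 ^ j) * 2 ^ (N div j)"
    using assms by (intro card_divisors_le) (auto simp: nat_less_iff)
  finally show "card {d. d dvd n} \<le> 2 * (N ^ (2 ^ j) * 2 ^ (N div j))" by simp
qed

section \<open>Points of a modular hyperbola in a short box\<close>

lemma card_residue_class_le:
  fixes V :: "int set" and p X r :: int
  assumes "p > 0" "X \<ge> 0" "\<And>v. v \<in> V \<Longrightarrow> \<bar>v\<bar> \<le> X" "\<And>v. v \<in> V \<Longrightarrow> v mod p = r"
  shows "finite V" "int (card V) * p \<le> 2 * X + 2 * p"
proof -
  have "V \<subseteq> {-X..X}" using assms(3) by (auto simp: abs_le_iff minus_le_iff)
  then show fin: "finite V" by (rule finite_subset) simp
  \<comment> \<open>With the remainder fixed, the quotient by \<open>p\<close> determines the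
    element, and the quotients fill an interval of length about \<open>2 * X / p\<close>.\<close>
  have inj: "inj_on (\<lambda>v. v div p) V"
    by (rule inj_onI) (metis assms(4) div_mult_mod_eq)
  have "(\<lambda>v. v div p) ` V \<subseteq> {(-X) div p..X div p}"
    using assms(1,3) by (auto intro!: zdiv_mono1 simp: abs_le_iff minus_le_iff)
  then have "card V \<le> card {(-X) div p..X div p}"
    using card_inj_on_le[OF inj] by blast
  then have "int (card V) \<le> X div p - (-X) div p + 1"
    using assms(1,2) zdiv_mono1[of "-X" X p] by auto
  then have "int (card V) * p \<le> (X div p - (-X) div p + 1) * p"
    using assms(1) by (intro mult_right_mono) auto
  also have "\<dots> = X div p * p - (-X) div p * p + p" by (simp add: algebra_simps)
  also have "\<dots> \<le> 2 * X + 2 * p"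
  proof -
    have "X div p * p \<le> X" using assms(1)
      by (metis div_mult_mod_eq le_add_same_cancel1 pos_mod_sign)
    moreover have "(-X) div p * p \<ge> - X - p"
      using assms(1) by (metis add_le_cancel_left div_mult_mod_eq less_imp_le pos_mod_bound diff_le_eq)
    ultimately show ?thesis using assms(1) by linarith
  qed
  finally show "int (card V) * p \<le> 2 * X + 2 * p" .
qed

text \<open>Dirichlet approximation gives a multiplier \<open>q \<le> Q\<close> for which
  \<open>q * a\<close> is congruent to a small \<open>r\<close>. Multiplying the congruence by
  \<open>q^2\<close> puts the product \<open>(q * x - r) * (q * y - r)\<close>, which equals
  \<open>q * v + r^2\<close> for \<open>v = q * x * y - r * (x + y)\<close>, into a fixed residue
  class. As \<open>q\<close> is a unit, \<open>v\<close> also stays in one class, and being small it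
  takes few values. Each value fixes the product, and then the divisor \<open>q * x - r\<close> of
  that product determines the point. \<open>Q\<close> stays free, to be balanced afterwards.\<close>

lemma card_modular_hyperbola_box_le:
  fixes p h Q N j :: nat and a c :: int
  defines "D \<equiv> 2 * (N ^ (2 ^ j) * 2 ^ (N div j))"
  assumes p: "prime p" and Q: "0 < Q" "Q < p" and j: "0 < j" and c: "\<not> int p dvd c"
    and N: "(real Q * real h + real p / real Q)\<^sup>2 < 2 ^ N"
  defines "S \<equiv> {(x, y). x \<in> {0..<int h} \<and> y \<in> {0..<int h} \<and> [(x - a) * (y - a) = c] (mod int p)}"
  shows "real (card S) * p \<le> (2 * (real Q * (real h)\<^sup>2 + 2 * real h * real p / real Q) + 2 * real p) * real D"
proof -
  have p0: "0 < p" using p by (simp add: prime_gt_0_nat)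
  obtain k q where q: "0 < q" "q \<le> int Q" and qk: "\<bar>of_int q * (of_int a / real p) - of_int k\<bar> < 1 / real Q"
    by (rule Dirichlet_approx[OF Q(1)])
  define r where "r = q * a - k * int p"
  have r: "\<bar>real_of_int r\<bar> \<le> real p / real Q"
  proof -
    have "real_of_int r = real p * (of_int q * (of_int a / real p) - of_int k)"
      using p0 by (simp add: r_def field_simps)
    then have "\<bar>real_of_int r\<bar> = real p * \<bar>of_int q * (of_int a / real p) - of_int k\<bar>"
      by (simp add: abs_mult)
    also have "\<dots> \<le> real p * (1 / real Q)"
      using qk by (intro mult_left_mono) auto
    finally show ?thesis by simp
  qed
  have qp: "coprime q (int p)"
  proof -
    have "\<not> int p dvd q" using q Q(2) zdvd_imp_le[of "int p" q] by auto
    then show ?thesis using p by (metis coprime_commute prime_imp_coprime prime_int_nat_transfer prime_nat_int_transfer)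
  qed
  define v where "v = (\<lambda>(x, y). q * x * y - r * (x + y))"
  define n where "n = (\<lambda>w. q * w + r\<^sup>2)"
  have nv: "n (v (x, y)) = (q * x - r) * (q * y - r)" for x y
    by (simp add: n_def v_def power2_eq_square algebra_simps)
  have finS: "finite S"
    by (rule finite_subset[of _ "{0..<int h} \<times> {0..<int h}"]) (auto simp: S_def)
  have ncong: "[n (v z) = q\<^sup>2 * c] (mod int p)" if "z \<in> S" for z
  proof -
    obtain x y where z: "z = (x, y)" by fastforce
    have "[q * x - r = q * (x - a)] (mod int p)" "[q * y - r = q * (y - a)] (mod int p)"
      by (auto simp: r_def cong_iff_dvd_diff algebra_simps)
    then have "[(q * x - r) * (q * y - r) = (q * (x - a)) * (q * (y - a))] (mod int p)"
      by (rule cong_mult)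
    also have "(q * (x - a)) * (q * (y - a)) = q\<^sup>2 * ((x - a) * (y - a))"
      by (simp add: power2_eq_square algebra_simps)
    also have "[\<dots> = q\<^sup>2 * c] (mod int p)"
      using that z by (intro cong_scalar_left) (auto simp: S_def)
    finally show ?thesis by (simp add: z nv)
  qed
  have vbound: "\<bar>real_of_int (v z)\<bar> \<le> real Q * (real h)\<^sup>2 + 2 * real h * real p / real Q" if "z \<in> S" for z
  proof -
    obtain x y where z: "z = (x, y)" by fastforce
    have xy: "0 \<le> x" "x < int h" "0 \<le> y" "y < int h" using that z by (auto simp: S_def)
    have xyr: "0 \<le> real_of_int x" "real_of_int x \<le> real h" "0 \<le> real_of_int y" "real_of_int y \<le> real h"
      using xy by linarith+
    have "\<bar>real_of_int (v z)\<bar> \<le> \<bar>real_of_int q * x * y\<bar> + \<bar>real_of_int r * (real_of_int x + y)\<bar>"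
      by (simp add: z v_def abs_triangle_ineq4)
    also have "\<bar>real_of_int q * x * y\<bar> \<le> real Q * real h * real h"
      unfolding abs_mult using q xyr by (intro mult_mono) auto
    also have "\<bar>real_of_int r * (real_of_int x + y)\<bar> \<le> (real p / real Q) * (2 * real h)"
      unfolding abs_mult using r xyr by (intro mult_mono) auto
    finally show ?thesis by (simp add: power2_eq_square algebra_simps)
  qed
  define X where "X = \<lfloor>real Q * (real h)\<^sup>2 + 2 * real h * real p / real Q\<rfloor>"
  have X: "0 \<le> X" "real_of_int X \<le> real Q * (real h)\<^sup>2 + 2 * real h * real p / real Q"
    by (simp_all add: X_def)
  have vmod: "v z mod int p = v z' mod int p" if "z \<in> S" "z' \<in> S" for z z'
  proof -
    have "[n (v z) = n (v z')] (mod int p)"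
      using ncong[OF that(1)] ncong[OF that(2)] by (metis cong_sym cong_trans)
    then have "[q * v z = q * v z'] (mod int p)" by (simp add: n_def cong_add_rcancel)
    then have "[v z = v z'] (mod int p)" using qp by (simp add: cong_mult_lcancel)
    then show ?thesis by (simp add: Cong.cong_def)
  qed
  have "\<exists>r0. \<forall>w\<in>v ` S. w mod int p = r0" using vmod by blast
  then obtain r0 where r0: "\<And>w. w \<in> v ` S \<Longrightarrow> w mod int p = r0" by blast
  have "\<bar>w\<bar> \<le> X" if w: "w \<in> v ` S" for w
  proof -
    obtain z where "z \<in> S" "w = v z" using w by blast
    then have "real_of_int \<bar>w\<bar> \<le> real Q * (real h)\<^sup>2 + 2 * real h * real p / real Q"
      using vbound by simp
    then show ?thesis by (simp only: X_def le_floor_iff)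
  qed
  then have cV: "int (card (v ` S)) * int p \<le> 2 * X + 2 * int p"
    using card_residue_class_le(2)[of "int p" X "v ` S" r0] p0 X r0 by auto
  have fibre: "card {z \<in> S. v z = w} \<le> D" if w: "w \<in> v ` S" for w
  proof -
    obtain z where z: "z \<in> S" "w = v z" using w by blast
    have "\<not> int p dvd q\<^sup>2 * c"
      using p c qp by (metis coprime_dvd_mult_right_iff coprime_commute coprime_power_right_iff)
    \<comment> \<open>Here \<open>c\<close> has to be a unit modulo \<open>p\<close>: the divisor
      bound says nothing about the integer 0.\<close>
    then have n0: "n w \<noteq> 0" using ncong[OF z(1)] z(2) by (metis cong_dvd_iff dvd_0_right)
    have lin: "\<bar>real_of_int (q * x - r)\<bar> \<le> real Q * real h + real p / real Q" if "0 \<le> x" "x < int h" for x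
    proof -
      have "\<bar>real_of_int (q * x - r)\<bar> \<le> \<bar>real_of_int q * x\<bar> + \<bar>real_of_int r\<bar>"
        by (simp add: abs_triangle_ineq4)
      also have "\<bar>real_of_int q * x\<bar> \<le> real Q * real h"
        unfolding abs_mult using q that by (intro mult_mono) auto
      finally show ?thesis using r by simp
    qed
    obtain x y where xy: "z = (x, y)" by fastforce
    have "real_of_int \<bar>n w\<bar> = \<bar>real_of_int (q * x - r)\<bar> * \<bar>real_of_int (q * y - r)\<bar>"
      by (simp add: z(2) xy nv abs_mult del: of_int_diff)
    also have "\<dots> \<le> (real Q * real h + real p / real Q) * (real Q * real h + real p / real Q)"
      using z(1) xy by (intro mult_mono lin) (auto simp: S_def)
    also have "\<dots> < 2 ^ N" using N by (simp add: power2_eq_square)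
    finally have "\<bar>n w\<bar> < 2 ^ N" by (metis of_int_less_iff of_int_numeral of_int_power)
    note div = card_int_divisors_le[OF n0 this j]
    have "inj_on (\<lambda>z. q * fst z - r) {z \<in> S. v z = w}"
    proof (rule inj_onI)
      fix z1 z2 assume 1: "z1 \<in> {z \<in> S. v z = w}" "z2 \<in> {z \<in> S. v z = w}"
        and eq: "q * fst z1 - r = q * fst z2 - r"
      obtain x1 y1 x2 y2 where zz: "z1 = (x1, y1)" "z2 = (x2, y2)" by fastforce
      have x: "x1 = x2" using eq q(1) zz by simp
      have e1: "n w = (q * x1 - r) * (q * y1 - r)" "n w = (q * x2 - r) * (q * y2 - r)"
        using 1 zz nv[of x1 y1] nv[of x2 y2] by auto
      then have "q * y1 - r = q * y2 - r" using n0 x by auto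
      then show "z1 = z2" using q(1) zz x by simp
    qed
    moreover have "(\<lambda>z. q * fst z - r) ` {z \<in> S. v z = w} \<subseteq> {d. d dvd n w}"
      using nv by (auto simp: image_iff)
    ultimately have "card {z \<in> S. v z = w} \<le> card {d. d dvd n w}"
      using div(1) by (rule card_inj_on_le)
    then show ?thesis using div(2) by (simp add: D_def)
  qed
  have "card S = card (\<Union>w\<in>v ` S. {z \<in> S. v z = w})" by (rule arg_cong[where f=card]) auto
  also have "\<dots> \<le> (\<Sum>w\<in>v ` S. card {z \<in> S. v z = w})" using finS by (intro card_UN_le) auto
  also have "\<dots> \<le> (\<Sum>w\<in>v ` S. D)" using fibre by (rule sum_mono)
  finally have "card S \<le> card (v ` S) * D" by simp
  then have "real (card S) * p \<le> real (card (v ` S) * D) * real p"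
    by (intro mult_right_mono) (simp_all only: of_nat_le_iff of_nat_0_le_iff)
  also have "\<dots> = real_of_int (int (card (v ` S)) * int p) * real D" by simp
  also have "\<dots> \<le> real_of_int (2 * X + 2 * int p) * real D"
    using cV by (intro mult_right_mono) (simp_all only: of_int_le_iff of_nat_0_le_iff)
  also have "\<dots> \<le> (2 * (real Q * (real h)\<^sup>2 + 2 * real h * real p / real Q) + 2 * real p) * real D"
    using X(2) by (intro mult_right_mono) auto
  finally show ?thesis .
qed

text \<open>The sizes \<open>Q * h^2\<close> and \<open>h * p / Q\<close> of the two parts of
  \<open>v\<close> balance at \<open>Q\<close> near \<open>\<sigma> = sqrt (p / h)\<close>. Rounding
  down costs at most a factor 2, so the range of \<open>v\<close> contributes
  \<open>10 * \<sigma> * h^2\<close>, which is \<open>10 * h / \<sigma>\<close> after division by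
  \<open>p = \<sigma>^2 * h\<close>.\<close>

lemma card_modular_hyperbola_le:
  fixes p h L j :: nat and a c :: int
  assumes p: "prime p" "2 < p" "p < 2 ^ L" and h: "0 < h" "h \<le> p" and j: "0 < j" and c: "\<not> int p dvd c"
  defines "S \<equiv> {(x, y). x \<in> {0..<int h} \<and> y \<in> {0..<int h} \<and> [(x - a) * (y - a) = c] (mod int p)}"
  shows "real (card S) \<le> (10 * real h / sqrt (real p / real h) + 2)
    * real (2 * ((4 * L) ^ (2 ^ j) * 2 ^ (4 * L div j)))"
proof -
  define \<sigma> where "\<sigma> = sqrt (real p / real h)"
  define Q where "Q = nat \<lfloor>\<sigma>\<rfloor>"
  define D where "D = 2 * ((4 * L) ^ (2 ^ j) * 2 ^ (4 * L div j))"
  have \<sigma>1: "1 \<le> \<sigma>" using h by (simp add: \<sigma>_def field_simps)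
  have \<sigma>2: "\<sigma> * \<sigma> * real h = real p" using h by (simp add: \<sigma>_def)
  have Q1: "1 \<le> Q" using \<sigma>1 unfolding Q_def by (simp add: le_nat_floor)
  have Q: "0 < Q" "real Q \<le> \<sigma>" "\<sigma> \<le> 2 * real Q"
    using Q1 \<sigma>1 floor_correct[of \<sigma>] unfolding Q_def by linarith+
  have Qp: "Q < p"
  proof -
    have "real Q * real Q \<le> \<sigma> * \<sigma>" using Q(2) by (intro mult_mono) auto
    also have "\<dots> \<le> \<sigma> * \<sigma> * real h" using h(1) by (simp add: mult_le_cancel_left1)
    finally have le: "Q * Q \<le> p" using \<sigma>2 by (metis of_nat_le_iff of_nat_mult)
    show ?thesis
    proof (rule ccontr)
      assume "\<not> Q < p"
      then have "p * p \<le> Q * Q" by (intro mult_le_mono) auto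
      with le have "p * p \<le> p * 1" by linarith
      with p(2) show False by simp
    qed
  qed
  have pQ: "real p / real Q \<le> 2 * \<sigma> * real h"
  proof -
    have "real p = \<sigma> * (\<sigma> * real h)" using \<sigma>2 by simp
    also have "\<dots> \<le> (2 * real Q) * (\<sigma> * real h)" using Q \<sigma>1 by (intro mult_right_mono) auto
    finally show ?thesis using Q(1) by (simp add: field_simps)
  qed
  \<comment> \<open>The exponent \<open>4 * L\<close> comes from
    \<open>(3 * \<sigma> * h)^2 = 9 * h * p \<le> p^4\<close>, using \<open>3 \<le> p\<close> and
    \<open>h \<le> p\<close>.\<close>
  have N: "(real Q * real h + real p / real Q)\<^sup>2 < 2 ^ (4 * L)"
  proof -
    have "real Q * real h + real p / real Q \<le> \<sigma> * real h + 2 * \<sigma> * real h"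
      using Q pQ by (intro add_mono mult_right_mono) auto
    then have "(real Q * real h + real p / real Q)\<^sup>2 \<le> (3 * \<sigma> * real h)\<^sup>2"
      by (intro power_mono) auto
    also have "\<dots> = 9 * real h * (\<sigma> * \<sigma> * real h)" by (simp add: power2_eq_square)
    also have "\<dots> = 9 * real h * real p" by (simp only: \<sigma>2)
    also have "\<dots> \<le> (real p * real p) * real p * real p"
    proof (intro mult_right_mono)
      have "9 * h \<le> (p * p) * p" using p(2) h(2) mult_le_mono[of 3 p 3 p] by (intro mult_le_mono) auto
      then show "9 * real h \<le> (real p * real p) * real p"
        by (metis of_nat_le_iff of_nat_mult of_nat_numeral)
    qed auto
    also have "\<dots> = real p ^ 4" by (simp add: numeral_eq_Suc)
    also have "\<dots> < (2 ^ L) ^ 4"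
      using p(3) by (intro power_strict_mono) (metis of_nat_less_iff of_nat_numeral of_nat_power, auto)
    also have "\<dots> = 2 ^ (4 * L)" by (simp add: mult.commute flip: power_mult)
    finally show ?thesis .
  qed
  have "real (card S) * p \<le> (2 * (real Q * (real h)\<^sup>2 + 2 * real h * real p / real Q) + 2 * real p) * real D"
    unfolding S_def D_def by (rule card_modular_hyperbola_box_le[OF p(1) Q(1) Qp j c N])
  also have "\<dots> \<le> (2 * (\<sigma> * (real h)\<^sup>2 + 2 * real h * (2 * \<sigma> * real h)) + 2 * real p) * real D"
    using Q(2) mult_left_mono[OF pQ, of "2 * real h"]
    by (intro mult_right_mono add_mono mult_left_mono) auto
  also have "\<dots> = (10 * \<sigma> * real h * real h + 2 * real p) * real D"
    by (simp add: power2_eq_square algebra_simps)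
  also have "\<dots> = (10 * real h / \<sigma> + 2) * real D * real p"
  proof -
    have "10 * \<sigma> * real h * real h = 10 * real h / \<sigma> * (\<sigma> * \<sigma> * real h)"
      using \<sigma>1 by simp
    also note \<sigma>2
    finally show ?thesis by (simp add: algebra_simps)
  qed
  finally show ?thesis using p(2) by (simp add: \<sigma>_def D_def)
qed

section \<open>Fibres of the product of two shifted ratios\<close>

lemma cong_mobius_product_hyperbola:
  fixes p x y s t l i :: int
  assumes ui: "[(1 - l) * i = 1] (mod p)" and eq: "[(x + s) * (y + s) = l * ((x + t) * (y + t))] (mod p)"
  shows "[(x - i * (l * t - s)) * (y - i * (l * t - s)) = i\<^sup>2 * l * (s - t)\<^sup>2] (mod p)"
proof -
  define u where "u = 1 - l"
  obtain k where k: "u * i = 1 + p * k" using ui by (metis cong_iff_lin cong_sym u_def)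
  obtain m where m: "(x + s) * (y + s) = l * ((x + t) * (y + t)) + p * m" using eq by (metis cong_iff_lin cong_sym)
  let ?a = "i * (l * t - s)"
  \<comment> \<open>Multiplying the equation by \<open>u = 1 - l\<close> completes it to a product
    of a function of \<open>x\<close> and a function of \<open>y\<close>. Multiplying each factor by
    the inverse \<open>i\<close> of \<open>u\<close> then gives the centred form.\<close>
  have "(u * x - l * t + s) * (u * y - l * t + s) - l * (s - t)\<^sup>2
      = u * ((x + s) * (y + s) - l * ((x + t) * (y + t)))"
    by (simp add: u_def power2_eq_square algebra_simps)
  then have 1: "[(u * x - l * t + s) * (u * y - l * t + s) = l * (s - t)\<^sup>2] (mod p)"
    using m by (simp add: cong_iff_dvd_diff)
  have ix: "[i * (u * z - l * t + s) = z - ?a] (mod p)" for z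
  proof -
    have "i * (u * z - l * t + s) - (z - ?a) = (u * i - 1) * z" by (simp add: algebra_simps)
    then show ?thesis using k by (simp add: cong_iff_dvd_diff)
  qed
  have "[(x - ?a) * (y - ?a) = (i * (u * x - l * t + s)) * (i * (u * y - l * t + s))] (mod p)"
    using ix by (intro cong_mult cong_sym[OF ix])
  also have "(i * (u * x - l * t + s)) * (i * (u * y - l * t + s))
      = i\<^sup>2 * ((u * x - l * t + s) * (u * y - l * t + s))" by (simp add: power2_eq_square)
  also have "[\<dots> = i\<^sup>2 * (l * (s - t)\<^sup>2)] (mod p)" using 1 by (rule cong_scalar_left)
  finally show ?thesis by (simp add: mult.assoc)
qed

text \<open>The condition \<open>l \<noteq> 1\<close> makes \<open>1 - l\<close> invertible, so that
  the fibre is a hyperbola. Its constant is a unit because \<open>l \<noteq> 0\<close> and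
  \<open>s \<noteq> t\<close>.\<close>

lemma card_mobius_product_fibre_le:
  fixes p h L j s t l :: nat
  assumes p: "prime p" "2 < p" "p < 2 ^ L" and h: "0 < h" "h \<le> p" and j: "0 < j"
    and st: "s < p" "t < p" "s \<noteq> t" and l: "l < p" "l \<noteq> 0" "l \<noteq> 1"
  defines "F \<equiv> {(x, y). x < h \<and> y < h \<and> [(x + s) * (y + s) = l * ((x + t) * (y + t))] (mod p)}"
  shows "real (card F) \<le> (10 * real h / sqrt (real p / real h) + 2)
    * real (2 * ((4 * L) ^ (2 ^ j) * 2 ^ (4 * L div j)))"
proof -
  have pi: "prime (int p)" using p(1) by simp
  have small: "\<not> int p dvd z" if "z \<noteq> 0" "\<bar>z\<bar> < int p" for z
    using that zdvd_imp_le[of "int p" "\<bar>z\<bar>"] by auto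
  have "coprime (1 - int l) (int p)"
    using small[of "1 - int l"] l pi by (auto simp: coprime_commute intro!: prime_imp_coprime)
  then obtain i where i: "[(1 - int l) * i = 1] (mod int p)" using cong_solve_coprime_int by blast
  have ip: "\<not> int p dvd i"
    using i pi by (metis cong_dvd_iff dvd_mult not_prime_unit)
  have c: "\<not> int p dvd i\<^sup>2 * int l * (int s - int t)\<^sup>2"
    using ip small[of "int l"] small[of "int s - int t"] l st pi
    by (auto simp: prime_dvd_mult_iff prime_dvd_power_iff)
  let ?a = "i * (int l * int t - int s)"
  let ?S = "{(x, y). x \<in> {0..<int h} \<and> y \<in> {0..<int h} \<and>
      [(x - ?a) * (y - ?a) = i\<^sup>2 * int l * (int s - int t)\<^sup>2] (mod int p)}"
  have "map_prod int int ` F \<subseteq> ?S"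
  proof -
    have "[(int x - ?a) * (int y - ?a) = i\<^sup>2 * int l * (int s - int t)\<^sup>2] (mod int p)"
      if "[(x + s) * (y + s) = l * ((x + t) * (y + t))] (mod p)" for x y
      using that by (intro cong_mobius_product_hyperbola[OF i]) (simp flip: cong_int_iff)
    then show ?thesis by (auto simp: F_def)
  qed
  moreover have "finite ?S"
    by (rule finite_subset[of _ "{0..<int h} \<times> {0..<int h}"]) auto
  moreover have "inj_on (map_prod int int) F" by (auto intro!: inj_onI)
  ultimately have "card F \<le> card ?S" by (intro card_inj_on_le)
  then show ?thesis using card_modular_hyperbola_le[OF p h j c, of ?a] by linarith
qed

text \<open>For ratio 1 the hyperbola degenerates: the difference of the two sides is
  \<open>(s - t) * (x + y + s + t)\<close>, so the fibre is a line on which \<open>x\<close>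
  determines \<open>y\<close>. The factor 1 is written out to match the general fibre at
  \<open>l = 1\<close>.\<close>

lemma card_mobius_product_fibre_one_le:
  fixes p h s t :: nat
  assumes p: "prime p" and h: "h \<le> p" and st: "s < p" "t < p" "s \<noteq> t"
  defines "F \<equiv> {(x, y). x < h \<and> y < h \<and> [(x + s) * (y + s) = 1 * ((x + t) * (y + t))] (mod p)}"
  shows "card F \<le> h"
proof -
  have pi: "prime (int p)" using p(1) by simp
  have sum: "[x + y + s + t = 0] (mod p)" if "(x, y) \<in> F" for x y
  proof -
    have "[(int x + s) * (int y + s) = (int x + t) * (int y + t)] (mod int p)"
      using that by (simp add: F_def flip: cong_int_iff)
    then have "int p dvd (int s - int t) * (int x + int y + int s + int t)"
      by (simp add: cong_iff_dvd_diff algebra_simps)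
    moreover have "\<not> int p dvd int s - int t"
      using st zdvd_imp_le[of "int p" "\<bar>int s - int t\<bar>"] by auto
    ultimately have "int p dvd int (x + y + s + t)" using pi by (auto simp: prime_dvd_mult_iff)
    then show ?thesis by (simp only: int_dvd_int_iff cong_0_iff)
  qed
  have "inj_on fst F"
  proof (rule inj_onI)
    fix z z' assume z: "z \<in> F" "z' \<in> F" "fst z = fst z'"
    obtain x y y' where e: "z = (x, y)" "z' = (x, y')" using z(3) by (metis prod.collapse)
    have "[(x + s + t) + y = (x + s + t) + y'] (mod p)"
      using sum[of x y] sum[of x y'] z e by (metis (no_types, lifting) add.assoc add.commute cong_sym cong_trans)
    then have "[y = y'] (mod p)" by (simp only: cong_add_lcancel_nat)
    moreover have "y < p" "y' < p" using z e h by (auto simp: F_def)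
    ultimately show "z = z'" using e by (simp add: Cong.cong_def)
  qed
  then have "card F \<le> card {..<h}" by (rule card_inj_on_le) (auto simp: F_def)
  then show ?thesis by simp
qed

section \<open>Agreement on a long enough interval forces equal shifts\<close>

lemma divisor_bound_le_power:
  fixes L j :: nat
  assumes "L < 4 ^ j"
  shows "(4 * L) ^ (2 ^ j) * 2 ^ (4 * L div j) \<le> (2::nat) ^ ((2 * j + 2) * 2 ^ j + 4 * L div j)"
proof -
  have "4 * L \<le> 4 * 4 ^ j" using assms by simp
  also have "\<dots> = 2 ^ (2 * j + 2)" by (simp add: power_add power_mult)
  finally have "(4 * L) ^ (2 ^ j) \<le> (2 ^ (2 * j + 2)) ^ (2 ^ j)" by (rule power_mono) simp
  also have "\<dots> = 2 ^ ((2 * j + 2) * 2 ^ j)" by (rule power_mult[symmetric])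
  finally show ?thesis by (simp only: power_add[of _ "(2 * j + 2) * 2 ^ j"] mult_le_mono1)
qed

text \<open>The \<open>h^2\<close> pairs spread over at most \<open>e\<close> fibres, one of size at
  most \<open>h\<close> and the others of size at most \<open>R\<close>. The two hypotheses on
  \<open>h\<close> match the two summands of \<open>R\<close>: \<open>A < h^2\<close> controls the
  constant 2, and \<open>A^2 < h * p\<close> controls \<open>10 * h / \<sigma>\<close>.\<close>

lemma agreeing_powers_imp_eq:
  fixes p e h L j s t :: nat
  assumes p: "prime p" "2 < p" "p < 2 ^ L" and j: "0 < j" "L < 4 ^ j" and e: "0 < e"
    and st: "s < p" "t < p"
    and agree: "\<And>x. x < h \<Longrightarrow> [(x + s) ^ e = (x + t) ^ e] (mod p)"
  defines "A \<equiv> 2 ^ ((2 * j + 2) * 2 ^ j + 4 * L div j + 6) * e"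
  assumes h: "A < h\<^sup>2" "A\<^sup>2 < h * p"
  shows "s = t"
proof (rule ccontr)
  assume ne: "s \<noteq> t"
  have p0: "0 < p" using p by simp
  \<comment> \<open>A zero of one power is a zero of the other, and a common zero of
    \<open>x + s\<close> and \<open>x + t\<close> would give \<open>s = t\<close>. So all
    denominators are units.\<close>
  have unit: "\<not> p dvd x + t" if "x < h" for x
  proof
    assume d: "p dvd x + t"
    then have "[(x + t) ^ e = 0] (mod p)" using e p(1) by (simp add: cong_0_iff prime_dvd_power_iff)
    then have "[(x + s) ^ e = 0] (mod p)" using agree[OF that] by (metis cong_trans)
    then have "p dvd x + s" using p(1) by (simp add: cong_0_iff prime_dvd_power_iff e)
    then have "[x + s = x + t] (mod p)" using d by (simp add: Cong.cong_def)
    then have "[s = t] (mod p)" by (simp only: cong_add_lcancel_nat)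
    then show False using st ne by (simp add: Cong.cong_def)
  qed
  \<comment> \<open>Otherwise the interval would contain \<open>p - t\<close>, where the denominator
    vanishes.\<close>
  have hp: "h \<le> p"
  proof (rule ccontr)
    assume "\<not> h \<le> p"
    then have "p - t < h" "p dvd (p - t) + t" using st by auto
    then show False using unit by blast
  qed
  have "(1::nat) \<le> 2 ^ ((2 * j + 2) * 2 ^ j + 4 * L div j)" by simp
  then have A64: "64 \<le> A" using e by (simp add: A_def power_add)
  then have h2: "2 \<le> h" using h(1) by (cases "h \<le> 1") (auto simp: le_Suc_eq)
  define F where "F = (\<lambda>l. {(x, y). x < h \<and> y < h \<and> [(x + s) * (y + s) = l * ((x + t) * (y + t))] (mod p)})"
  define G where "G = {l \<in> {..<p}. [l ^ e = 1] (mod p)}"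
  define R where "R = (10 * real h / sqrt (real p / real h) + 2)
    * real (2 * ((4 * L) ^ (2 ^ j) * 2 ^ (4 * L div j)))"
  have R0: "0 \<le> R" by (simp add: R_def)
  have finF: "finite (F l)" for l
    by (rule finite_subset[of _ "{..<h} \<times> {..<h}"]) (auto simp: F_def)
  have finG: "finite G" by (simp add: G_def)
  have cG: "card G \<le> e" using roots_mod_prime_bound[OF p(1) e, of 1] by (simp add: G_def)
  have one: "1 \<in> G" using p(2) by (simp add: G_def)
  have "{..<h} \<times> {..<h} \<subseteq> (\<Union>l\<in>G. F l)"
  proof
    fix z assume "z \<in> {..<h} \<times> {..<h}"
    then obtain x y where z: "z = (x, y)" and xy: "x \<in> {..<h}" "y \<in> {..<h}" by blast
    define w where "w = (x + t) * (y + t)"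
    \<comment> \<open>The quotient of \<open>(x + s) * (y + s)\<close> by \<open>w\<close>, with
      \<open>w ^ (p - 2)\<close> as the inverse by Fermat.\<close>
    define l where "l = ((x + s) * (y + s) * w ^ (p - 2)) mod p"
    have w: "\<not> p dvd w" using unit xy p(1) by (simp add: w_def prime_dvd_mult_iff)
    have l: "[l = (x + s) * (y + s) * w ^ (p - 2)] (mod p)" by (simp add: l_def)
    have "[l * w = (x + s) * (y + s) * w ^ (p - 2) * w] (mod p)" using l by (rule cong_scalar_right)
    also have "(x + s) * (y + s) * w ^ (p - 2) * w = (x + s) * (y + s) * w ^ (p - 1)"
    proof -
      have "p - 1 = Suc (p - 2)" using p(2) by simp
      then show ?thesis by simp
    qed
    also have "[\<dots> = (x + s) * (y + s) * 1] (mod p)"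
      using fermat_theorem[OF p(1) w] by (rule cong_scalar_left)
    finally have lw: "[l * w = (x + s) * (y + s)] (mod p)" by simp
    have "[l ^ e * w ^ e = ((x + s) * (y + s)) ^ e] (mod p)"
      using cong_pow[OF lw, of e] by (simp add: power_mult_distrib)
    also have "((x + s) * (y + s)) ^ e = (x + s) ^ e * (y + s) ^ e" by (simp add: power_mult_distrib)
    also have "[\<dots> = (x + t) ^ e * (y + t) ^ e] (mod p)" using agree xy by (intro cong_mult) auto
    also have "(x + t) ^ e * (y + t) ^ e = 1 * w ^ e" by (simp add: w_def power_mult_distrib)
    finally have "[l ^ e * w ^ e = 1 * w ^ e] (mod p)" .
    moreover have "coprime (w ^ e) p"
      using w p(1) by (simp add: coprime_commute prime_imp_coprime)
    ultimately have "[l ^ e = 1] (mod p)" by (simp only: cong_mult_rcancel_nat)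
    then have "l \<in> G" using p0 by (simp add: G_def l_def)
    moreover have "(x, y) \<in> F l" using cong_sym[OF lw] xy by (simp add: F_def w_def)
    ultimately show "z \<in> (\<Union>l\<in>G. F l)" using z by blast
  qed
  then have "card ({..<h} \<times> {..<h}) \<le> card (\<Union>l\<in>G. F l)"
    using finG finF by (intro card_mono) auto
  also have "\<dots> \<le> (\<Sum>l\<in>G. card (F l))" using finG by (rule card_UN_le)
  also have "\<dots> = card (F 1) + (\<Sum>l\<in>G - {1}. card (F l))"
    using one finG by (simp add: sum.remove)
  also have "card (F 1) \<le> h"
    unfolding F_def by (rule card_mobius_product_fibre_one_le[OF p(1) hp st ne])
  finally have "h * h \<le> h + (\<Sum>l\<in>G - {1}. card (F l))" by simp
  then have "real h * real h \<le> real h + (\<Sum>l\<in>G - {1}. real (card (F l)))"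
    by (metis of_nat_add of_nat_le_iff of_nat_mult of_nat_sum)
  also have "(\<Sum>l\<in>G - {1}. real (card (F l))) \<le> (\<Sum>l\<in>G - {1}. R)"
  proof (rule sum_mono)
    fix l assume l: "l \<in> G - {1}"
    have "l \<noteq> 0"
    proof
      assume "l = 0"
      then have "[0 = 1] (mod p)" using l e by (simp add: G_def power_0_left)
      then show False using p(2) by (simp add: Cong.cong_def)
    qed
    then show "real (card (F l)) \<le> R"
      unfolding F_def R_def using l h2 hp
      by (intro card_mobius_product_fibre_le p j st ne) (auto simp: G_def)
  qed
  also have "\<dots> \<le> real e * R"
  proof -
    have "card (G - {1}) \<le> e" using cG card_mono[of G "G - {1}"] finG by auto
    then show ?thesis using R0 by (simp add: mult_right_mono)
  qed
  finally have main: "real h * real h \<le> real h + real e * R" by simp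
  define \<sigma> where "\<sigma> = sqrt (real p / real h)"
  have \<sigma>: "0 < \<sigma>" using p0 h2 by (simp add: \<sigma>_def)
  have \<sigma>2: "\<sigma> * \<sigma> * real h = real p" using h2 by (simp add: \<sigma>_def)
  have "(real A)\<^sup>2 < real h * real p" using h(2) by (metis of_nat_less_iff of_nat_mult of_nat_power)
  also have "real h * real p = (real h * \<sigma>)\<^sup>2"
    unfolding \<sigma>2[symmetric] by (simp add: power2_eq_square)
  finally have "real A < real h * \<sigma>" by (rule power2_less_imp_less) (use \<sigma> in simp)
  \<comment> \<open>The hypothesis \<open>A^2 < h * p\<close> has become
    \<open>A < h * \<sigma>\<close>, which is the bound needed for the summand
    \<open>10 * h / \<sigma>\<close>.\<close>
  then have 1: "real A * (real h / \<sigma>) \<le> real h * real h"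
  proof -
    have "real A * (real h / \<sigma>) \<le> real h * \<sigma> * (real h / \<sigma>)"
      using \<open>real A < real h * \<sigma>\<close> \<sigma> by (intro mult_right_mono) auto
    then show ?thesis using \<sigma> by simp
  qed
  have 2: "real A \<le> real h * real h"
    using h(1) by (metis less_imp_le of_nat_le_iff of_nat_mult power2_eq_square)
  \<comment> \<open>The 64 is the summand 6 in the exponent of \<open>A\<close>. \<open>R\<close>
    contains a factor 2, so 32 remains: \<open>32 * e * R \<le> 12 * h^2\<close>. Together with
    \<open>main\<close> this gives \<open>20 * h^2 \<le> 32 * h\<close>, which is false for
    \<open>h \<ge> 2\<close>.\<close>
  have D: "64 * e * ((4 * L) ^ (2 ^ j) * 2 ^ (4 * L div j)) \<le> A"
    using mult_left_mono[OF divisor_bound_le_power[OF j(2)], of "64 * e"]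
    by (simp add: A_def power_add mult.commute)
  then have "real (64 * e * ((4 * L) ^ (2 ^ j) * 2 ^ (4 * L div j))) \<le> real A"
    by (simp only: of_nat_le_iff)
  then have "32 * (real e * R) \<le> (10 * real h / \<sigma> + 2) * real A"
    using mult_left_mono[of "real (64 * e * ((4 * L) ^ (2 ^ j) * 2 ^ (4 * L div j)))" "real A" "10 * real h / \<sigma> + 2"] \<sigma>
    by (simp add: R_def \<sigma>_def[symmetric] mult_ac)
  also have "\<dots> = 10 * (real A * (real h / \<sigma>)) + 2 * real A" by (simp add: algebra_simps)
  also have "\<dots> \<le> 12 * (real h * real h)" using 1 2 by linarith
  finally have "32 * (real h * real h) \<le> 32 * real h + 12 * (real h * real h)"
    using main by linarith
  moreover have "2 * real h \<le> real h * real h" using h2 by (intro mult_right_mono) auto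
  moreover have "0 < real h * real h" using h2 by simp
  ultimately show False by linarith
qed

section \<open>The program\<close>

text \<open>
  Registers: 0 holds \<open>p\<close>, 1 holds \<open>e\<close>, 2 the constant \<open>1\<close>, 3 the bit length \<open>L\<close> of \<open>p\<close>, 6 the base-4
  length \<open>j\<close> of \<open>L\<close>, 8 the power \<open>2\<^sup>j\<close>, 9 the exponent \<open>M\<close>, 10 the threshold \<open>A = 2\<^sup>M e\<close>, 11 the query
  point \<open>x\<close>, 12 the square \<open>A\<^sup>2\<close>. Register 15 is never written, so that \<open>Jz 15\<close> is an unconditional
  jump. The program accepts once \<open>x\<^sup>2 > A\<close> and \<open>x p > A\<^sup>2\<close>, which avoids computing square roots.
\<close>

definition decision_prog :: "instr list" where
  "decision_prog =
    [Const 2 1, Const 4 1,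
     Sub 5 0 4, Jneg 5 7, Add 4 4 4, Add 3 3 2, Jz 15 2,
     Const 7 1, Const 8 1,
     Sub 5 3 7, Jneg 5 16, Add 7 7 7, Add 7 7 7, Add 8 8 8, Add 6 6 2, Jz 15 9,
     Add 9 6 2, Add 9 9 9, Mul 9 9 8, Add 5 3 3, Add 5 5 5, Div 5 5 6, Add 9 9 5, Const 5 6,
     Add 9 9 5, Add 10 1 15,
     Jz 9 30, Add 10 10 10, Sub 9 9 2, Jz 15 26,
     Mul 12 10 10,
     Mul 5 11 11, Sub 5 10 5, Jneg 5 35, Jz 15 38,
     Mul 5 11 0, Sub 5 12 5, Jneg 5 45,
     Query1 13 11, Query2 14 11, Sub 5 13 14, Jz 5 43, Halt 15,
     Add 11 11 2, Jz 15 31,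
     Halt 2]"

lemma length_prog: "length decision_prog = 46"
  by (simp add: decision_prog_def)

lemma decision_prog_nth:
  "decision_prog ! 0 = Const 2 1" "decision_prog ! Suc 0 = Const 4 1"
  "decision_prog ! 2 = Sub 5 0 4" "decision_prog ! 3 = Jneg 5 7" "decision_prog ! 4 = Add 4 4 4" "decision_prog ! 5 = Add 3 3 2"
  "decision_prog ! 6 = Jz 15 2" "decision_prog ! 7 = Const 7 1" "decision_prog ! 8 = Const 8 1" "decision_prog ! 9 = Sub 5 3 7"
  "decision_prog ! 10 = Jneg 5 16" "decision_prog ! 11 = Add 7 7 7" "decision_prog ! 12 = Add 7 7 7" "decision_prog ! 13 = Add 8 8 8"
  "decision_prog ! 14 = Add 6 6 2" "decision_prog ! 15 = Jz 15 9" "decision_prog ! 16 = Add 9 6 2" "decision_prog ! 17 = Add 9 9 9"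
  "decision_prog ! 18 = Mul 9 9 8" "decision_prog ! 19 = Add 5 3 3" "decision_prog ! 20 = Add 5 5 5" "decision_prog ! 21 = Div 5 5 6"
  "decision_prog ! 22 = Add 9 9 5" "decision_prog ! 23 = Const 5 6" "decision_prog ! 24 = Add 9 9 5" "decision_prog ! 25 = Add 10 1 15"
  "decision_prog ! 26 = Jz 9 30" "decision_prog ! 27 = Add 10 10 10" "decision_prog ! 28 = Sub 9 9 2" "decision_prog ! 29 = Jz 15 26"
  "decision_prog ! 30 = Mul 12 10 10" "decision_prog ! 31 = Mul 5 11 11" "decision_prog ! 32 = Sub 5 10 5" "decision_prog ! 33 = Jneg 5 35"
  "decision_prog ! 34 = Jz 15 38" "decision_prog ! 35 = Mul 5 11 0" "decision_prog ! 36 = Sub 5 12 5" "decision_prog ! 37 = Jneg 5 45"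
  "decision_prog ! 38 = Query1 13 11" "decision_prog ! 39 = Query2 14 11" "decision_prog ! 40 = Sub 5 13 14" "decision_prog ! 41 = Jz 5 43"
  "decision_prog ! 42 = Halt 15" "decision_prog ! 43 = Add 11 11 2" "decision_prog ! 44 = Jz 15 31" "decision_prog ! 45 = Halt 2"
  by (simp_all add: decision_prog_def)

text \<open>Executing at most \<open>n\<close> instructions, each of cost at most \<open>C\<close>, halts with answer \<open>b\<close>. Loops are
  verified in continuation style: whatever halts after the loop also halts from its entry.\<close>

primrec halts_in :: "instr list \<Rightarrow> (int \<Rightarrow> int) \<Rightarrow> (int \<Rightarrow> int) \<Rightarrow> nat \<Rightarrow> bool \<Rightarrow> nat \<Rightarrow> nat
    \<Rightarrow> (int \<Rightarrow> int) \<Rightarrow> bool" where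
  "halts_in P f g C b 0 pc m \<longleftrightarrow> False"
| "halts_in P f g C b (Suc n) pc m \<longleftrightarrow>
    (case step P f g pc m of (st, d) \<Rightarrow> d \<le> C \<and>
      (case st of Running pc' m' \<Rightarrow> halts_in P f g C b n pc' m' | Halted b' \<Rightarrow> b' = b))"

text \<open>Lets the simplifier peel off a literal number of instructions while the remaining step
  count stays symbolic.\<close>

lemma halts_in_numeral:
  "halts_in P f g C b (numeral k + n) pc m \<longleftrightarrow>
    (case step P f g pc m of (st, d) \<Rightarrow> d \<le> C \<and>
      (case st of Running pc' m' \<Rightarrow> halts_in P f g C b (pred_numeral k + n) pc' m' | Halted b' \<Rightarrow> b' = b))"
  by (simp add: numeral_eq_Suc)

lemma halts_in_mono: "halts_in P f g C b n pc m \<Longrightarrow> n \<le> n' \<Longrightarrow> halts_in P f g C b n' pc m"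
proof (induction n arbitrary: n' pc m)
  case (Suc n)
  then obtain n'' where "n' = Suc n''" "n \<le> n''" by (cases n') auto
  then show ?case using Suc by (auto split: prod.splits state.splits)
qed simp

lemma halts_in_exec:
  assumes "halts_in P f g C b n pc m"
  shows "\<exists>k c. exec P f g k (Running pc m) c0 = (Halted b, c0 + c) \<and> c \<le> C * n"
  using assms
proof (induction n arbitrary: pc m c0)
  case (Suc n)
  obtain st d where st: "step P f g pc m = (st, d)" by fastforce
  then have d: "d \<le> C" using Suc.prems by simp
  show ?case
  proof (cases st)
    case (Running pc' m')
    then have "halts_in P f g C b n pc' m'" using Suc.prems st by simp
    from Suc.IH[OF this, of "c0 + d"] obtain k c
      where "exec P f g k (Running pc' m') (c0 + d) = (Halted b, c0 + d + c)" "c \<le> C * n" by blast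
    then have "exec P f g (Suc k) (Running pc m) c0 = (Halted b, c0 + (d + c)) \<and> d + c \<le> C * Suc n"
      using st d Running by simp
    then show ?thesis by blast
  next
    case (Halted b')
    then have "exec P f g (Suc 0) (Running pc m) c0 = (Halted b, c0 + d) \<and> d \<le> C * Suc n"
      using Suc.prems st d by simp
    then show ?thesis by blast
  qed
qed simp

section \<open>Register sizes and the cost of one instruction\<close>

definition small :: "nat \<Rightarrow> int \<Rightarrow> bool" where
  "small K x \<longleftrightarrow> \<bar>x\<bar> < 2 ^ K"

text \<open>For operands below \<open>2 ^ K\<close> the bit length is at most \<open>K + 1\<close>,
  so sums of two lengths are at most \<open>2 * K + 2\<close> and products at most
  \<open>(K + 1)^2\<close>. A single square dominates both, and also the unit costs.\<close>

definition cost_bound :: "nat \<Rightarrow> nat" where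
  "cost_bound K = (K + 2)\<^sup>2"

lemma bitlen_le:
  assumes "small K x"
  shows "Defs.bitlen x \<le> K + 1"
proof -
  have "\<bar>x\<bar> + 1 \<le> 2 ^ K" using assms by (simp add: small_def)
  then have "real_of_int (\<bar>x\<bar> + 1) \<le> real_of_int (2 ^ K)" by (simp only: of_int_le_iff)
  then have "real_of_int \<bar>x\<bar> + 1 \<le> 2 powr real K" by (simp add: powr_realpow)
  then have "log 2 (real_of_int \<bar>x\<bar> + 1) \<le> real K"
    by (subst log_le_iff) linarith+
  then have "\<lceil>log 2 (real_of_int \<bar>x\<bar> + 1)\<rceil> \<le> int K"
    by (simp only: ceiling_le_iff of_int_of_nat_eq)
  then show ?thesis unfolding Defs.bitlen_def by linarith
qed

lemma cost_bound_ge: "2 * K + 2 \<le> cost_bound K" "(K + 1) * (K + 1) \<le> cost_bound K"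
proof -
  have "2 * (K + 2) \<le> (K + 2) * (K + 2)" by (intro mult_le_mono) simp_all
  then show "2 * K + 2 \<le> cost_bound K" by (simp add: cost_bound_def power2_eq_square)
  show "(K + 1) * (K + 1) \<le> cost_bound K"
    unfolding cost_bound_def power2_eq_square by (intro mult_le_mono) simp_all
qed

lemma one_le_cost_bound: "Suc 0 \<le> cost_bound K"
  using cost_bound_ge(1)[of K] by linarith

lemma bitlen_cost_le: "small K x \<Longrightarrow> Defs.bitlen x \<le> cost_bound K"
  using cost_bound_ge(1)[of K] bitlen_le[of K x] by linarith

lemma bitlen_add_cost_le:
  "small K x \<Longrightarrow> small K y \<Longrightarrow> Defs.bitlen x + Defs.bitlen y \<le> cost_bound K"
  using cost_bound_ge(1)[of K] bitlen_le[of K x] bitlen_le[of K y] by linarith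

lemma bitlen_mult_cost_le:
  assumes "small K x" "small K y"
  shows "Defs.bitlen x * Defs.bitlen y \<le> cost_bound K"
  using mult_le_mono[OF bitlen_le[OF assms(1)] bitlen_le[OF assms(2)]] cost_bound_ge(2)
  by (rule order_trans)

lemma small_mono: "small K x \<Longrightarrow> \<bar>y\<bar> \<le> \<bar>x\<bar> \<Longrightarrow> small K y"
  by (simp add: small_def)

lemma small_le: "small K y \<Longrightarrow> 0 \<le> x \<Longrightarrow> x \<le> y \<Longrightarrow> small K x"
  by (simp add: small_def)

lemmas exec_simps = halts_in_numeral step_def decision_prog_nth length_prog bitlen_cost_le
  bitlen_add_cost_le bitlen_mult_cost_le one_le_cost_bound

section \<open>The four loops of the program\<close>

lemma loop_bits:
  fixes p L K i n :: nat
  assumes L: "2 ^ (L - 1) \<le> p" "p < 2 ^ L" and K: "small K (2 ^ L)" and i: "i \<le> L"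
    and m: "m 0 = int p" "m 2 = 1" "m 15 = 0" "m 3 = int i" "m 4 = 2 ^ i"
    and cont: "\<And>m'. (\<forall>r. r \<notin> {3, 4, 5} \<longrightarrow> m' r = m r) \<Longrightarrow> m' 3 = int L \<Longrightarrow>
      halts_in decision_prog f g (cost_bound K) b n 7 m'"
  shows "halts_in decision_prog f g (cost_bound K) b (2 + (n + 5 * (L - i))) 2 m"
  using i m cont
\<comment> \<open>Induction on the remaining rounds: five instructions per round, and two for the
  final test that finds \<open>p < 2 ^ L\<close>.\<close>
proof (induction "L - i" arbitrary: i m)
  case 0
  note m = "0.prems"(2-6) and cont = "0.prems"(7)
  have i: "i = L" using 0 by simp
  have pz: "int p < 2 ^ L" using L(2) by simp
  have "small K (int p)" using pz by (intro small_mono[OF K]) simp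
  moreover have "halts_in decision_prog f g (cost_bound K) b n 7 (m(5 := m 0 - m 4))"
    using m i by (intro cont) auto
  ultimately show ?case
    using m i pz K by (simp add: exec_simps)
next
  case (Suc k)
  note m = "Suc.prems"(2-6) and cont = "Suc.prems"(7)
  have i: "i < L" using Suc by simp
  have pz: "int p < 2 ^ L" using L(2) by simp
  have "(2::nat) ^ i \<le> 2 ^ (L - 1)" using i by (intro power_increasing) auto
  then have "2 ^ i \<le> p" using L(1) by linarith
  then have le: "2 ^ i \<le> int p" by (metis of_nat_le_iff of_nat_numeral of_nat_power)
  have s: "small K (int p)" "small K (2 ^ i)" "small K (int i)" "small K 1"
  proof -
    have "i \<le> 2 ^ L" using i less_exp[of L] by linarith
    then have "int i \<le> 2 ^ L" by (metis of_nat_le_iff of_nat_numeral of_nat_power)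
    then show "small K (int p)" "small K (2 ^ i)" "small K (int i)" "small K 1"
      using pz le i by (intro small_mono[OF K]; simp)+
  qed
  let ?m = "m(5 := int p - 2 ^ i, 4 := 2 ^ Suc i, 3 := int (Suc i))"
  have "halts_in decision_prog f g (cost_bound K) b (2 + (n + 5 * (L - Suc i))) 2 ?m"
    using Suc.hyps(2) i m by (intro Suc.hyps(1) cont) auto
  moreover have "2 + (n + 5 * (L - i)) = 5 + (2 + (n + 5 * (L - Suc i)))" using i by simp
  ultimately show ?case
    using m le s by (simp add: exec_simps add.commute)
qed


lemma loop_quarter_bits:
  fixes L K i j n :: nat
  assumes j: "4 ^ (j - 1) \<le> L" "L < 4 ^ j" and K: "small K (4 ^ j)" and i: "i \<le> j"
    and m: "m 2 = 1" "m 15 = 0" "m 3 = int L" "m 6 = int i" "m 7 = 4 ^ i" "m 8 = 2 ^ i"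
    and cont: "\<And>m'. (\<forall>r. r \<notin> {5, 6, 7, 8} \<longrightarrow> m' r = m r) \<Longrightarrow> m' 6 = int j \<Longrightarrow> m' 8 = 2 ^ j \<Longrightarrow>
      halts_in decision_prog f g (cost_bound K) b n 16 m'"
  shows "halts_in decision_prog f g (cost_bound K) b (2 + (n + 7 * (j - i))) 9 m"
  using i m cont
proof (induction "j - i" arbitrary: i m)
  case 0
  note m = "0.prems"(2-7) and cont = "0.prems"(8)
  have i: "i = j" using 0 by simp
  have Lz: "int L < 4 ^ j" using j(2) by simp
  have "small K (int L)" using Lz by (intro small_mono[OF K]) simp
  moreover have "halts_in decision_prog f g (cost_bound K) b n 16 (m(5 := m 3 - m 7))"
    using m i by (intro cont) auto
  ultimately show ?case
    using m i Lz K by (simp add: exec_simps)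
next
  case (Suc k)
  note m = "Suc.prems"(2-7) and cont = "Suc.prems"(8)
  have i: "i < j" using Suc by simp
  have Lz: "int L < 4 ^ j" using j(2) by simp
  have "(4::nat) ^ i \<le> 4 ^ (j - 1)" using i by (intro power_increasing) auto
  then have "4 ^ i \<le> L" using j(1) by linarith
  then have le: "4 ^ i \<le> int L" by (metis of_nat_le_iff of_nat_numeral of_nat_power)
  \<comment> \<open>\<open>2 * 4 ^ i\<close> is the content of register 7 between its two
    doublings.\<close>
  have s: "small K (int L)" "small K (4 ^ i)" "small K (2 * 4 ^ i)" "small K (2 ^ i)" "small K (int i)" "small K 1"
  proof -
    have i1: "(4::int) * 4 ^ i \<le> 4 ^ j" using i power_increasing[of "Suc i" j "4::int"] by simp
    have i2: "(2::int) ^ i \<le> 4 ^ i" by (rule power_mono) auto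
    have i3: "int i < 2 ^ i" using less_exp[of i] by (metis of_nat_less_iff of_nat_numeral of_nat_power)
    have i4: "(1::int) \<le> 2 ^ i" by simp
    show "small K (int L)" "small K (4 ^ i)" "small K (2 * 4 ^ i)" "small K (2 ^ i)" "small K (int i)" "small K 1"
      using Lz le i1 i2 i3 i4 by - (rule small_le[OF K]; linarith)+
  qed
  let ?m = "m(5 := int L - 4 ^ i, 7 := 4 ^ Suc i, 8 := 2 ^ Suc i, 6 := int (Suc i))"
  have "halts_in decision_prog f g (cost_bound K) b (2 + (n + 7 * (j - Suc i))) 9 ?m"
    using Suc.hyps(2) i m by (intro Suc.hyps(1) cont) auto
  moreover have "2 + (n + 7 * (j - i)) = 7 + (2 + (n + 7 * (j - Suc i)))" using i by simp
  ultimately show ?case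
    using m le s by (simp add: exec_simps add.commute)
qed

lemma loop_double:
  fixes K i n :: nat and a :: int
  assumes K: "small K (2 ^ i * a)" "small K (int i)" and a: "0 < a"
    and m: "m 2 = 1" "m 15 = 0" "m 9 = int i" "m 10 = a"
    and cont: "\<And>m'. (\<forall>r. r \<notin> {9, 10} \<longrightarrow> m' r = m r) \<Longrightarrow> m' 10 = 2 ^ i * a \<Longrightarrow>
      halts_in decision_prog f g (cost_bound K) b n 30 m'"
  shows "halts_in decision_prog f g (cost_bound K) b (1 + (n + 4 * i)) 26 m"
  using assms
\<comment> \<open>A round replaces the counter \<open>Suc i\<close> by \<open>i\<close> and
  \<open>a\<close> by \<open>2 * a\<close>, which leaves the target product unchanged; hence
  \<open>a\<close> is generalised.\<close>
proof (induction i arbitrary: a m)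
  case 0
  then show ?case by (simp add: exec_simps)
next
  case (Suc i)
  note m = Suc.prems(4-7) and cont = Suc.prems(8)
  have s: "small K a" "small K (int i)" "small K (2 ^ i * (2 * a))" "small K 1"
  proof -
    have "1 * a \<le> 2 ^ Suc i * a" using Suc.prems(3) by (intro mult_right_mono one_le_power) auto
    then show "small K a" using Suc.prems(3) by (intro small_le[OF Suc.prems(1)]) auto
    show "small K (int i)" "small K 1" by (intro small_le[OF Suc.prems(2)]; simp)+
    show "small K (2 ^ i * (2 * a))" using Suc.prems(1) by (simp add: mult_ac)
  qed
  let ?m = "m(10 := 2 * a, 9 := int i)"
  have "halts_in decision_prog f g (cost_bound K) b (1 + (n + 4 * i)) 26 ?m"
    using m s Suc.prems(3) by (intro Suc.IH cont) auto
  moreover have "1 + (n + 4 * Suc i) = 4 + (1 + (n + 4 * i))" by simp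
  ultimately show ?case
    using m s Suc.prems(2) by (simp add: exec_simps)
qed

text \<open>The premise \<open>exit\<close> says that \<open>h\<close> is the first point passing
  both acceptance tests, so the loop either meets a disagreement before \<open>h\<close> or accepts
  exactly there. A full round takes at most 12 instructions.\<close>

lemma loop_query:
  fixes p x h n K A :: nat
  assumes x: "x \<le> h"
    and exit: "\<And>y. y \<le> h \<Longrightarrow> A < y\<^sup>2 \<and> A\<^sup>2 < y * p \<longleftrightarrow> y = h"
    and K: "small K (int p)" "small K (int (A\<^sup>2))" "small K (int (h\<^sup>2))" "small K (int (h * p))"
    and m: "m 0 = int p" "m 2 = 1" "m 10 = int A" "m 11 = int x" "m 12 = int (A\<^sup>2)" "m 15 = 0"
    and fg: "\<And>y. small K (f y)" "\<And>y. small K (g y)"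
    and b: "b \<longleftrightarrow> (\<forall>y. x \<le> y \<and> y < h \<longrightarrow> f (int y) = g (int y))"
  shows "halts_in decision_prog f g (cost_bound K) b (12 + (n + 12 * (h - x))) 31 m"
  using x m b
proof (induction "h - x" arbitrary: x m)
  case 0
  note m = "0.prems"(2-7) and b = "0.prems"(8)
  have x: "x = h" using 0 by simp
  have ex: "A < x\<^sup>2" "A\<^sup>2 < x * p" using exit[of x] x by auto
  have c: "int A - int x * int x < 0" "int (A\<^sup>2) - int x * int p < 0"
    using ex by (simp_all add: power2_eq_square flip: of_nat_mult)
  have s: "small K (int x)" "small K (int A)" "small K (int x * int x)" "small K (int x * int p)"
  proof -
    have "x * x \<le> h\<^sup>2" "x * p \<le> h * p" "A \<le> A\<^sup>2" "x \<le> h\<^sup>2"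
      using x by (auto simp: power2_eq_square)
    then show "small K (int x)" "small K (int A)" "small K (int x * int x)" "small K (int x * int p)"
      using K by (auto simp flip: of_nat_mult intro: small_le)
  qed
  show ?case
    using m s c K x b by (simp add: exec_simps)
next
  case (Suc k)
  note m = "Suc.prems"(2-7) and b = "Suc.prems"(8)
  have x: "x < h" using Suc by simp
  have ex: "A < x\<^sup>2 \<Longrightarrow> \<not> A\<^sup>2 < x * p" using exit[of x] x by auto
  have c: "int A - int x * int x < 0 \<Longrightarrow> \<not> int (A\<^sup>2) - int x * int p < 0"
    using ex by (simp add: power2_eq_square flip: of_nat_mult)
  have s: "small K (int x)" "small K (int A)" "small K (int x * int x)" "small K (int x * int p)" "small K 1"
  proof -
    have "x * x \<le> h\<^sup>2" "x * p \<le> h * p" "A \<le> A\<^sup>2" "x \<le> h\<^sup>2" "1 \<le> h\<^sup>2"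
      using x mult_le_mono[of x h x h] mult_le_mono[of 1 h x h] by (auto simp: power2_eq_square)
    then show "small K (int x)" "small K (int A)" "small K (int x * int x)" "small K (int x * int p)"
      using K by (auto simp flip: of_nat_mult intro: small_le)
    show "small K 1" using \<open>1 \<le> h\<^sup>2\<close> by - (rule small_le[OF K(3)]; linarith)
  qed
  define N where "N = 12 + (n + 12 * (h - Suc x))"
  have count: "12 + (n + 12 * (h - x)) = 12 + N" using x by (simp add: N_def)
  show ?case
  proof (cases "f (int x) = g (int x)")
    case True
    have split: "x \<le> y \<longleftrightarrow> y = x \<or> Suc x \<le> y" for y by auto
    have b': "b \<longleftrightarrow> (\<forall>y. Suc x \<le> y \<and> y < h \<longrightarrow> f (int y) = g (int y))"
      unfolding b split using True by auto
    have IH: "halts_in decision_prog f g (cost_bound K) b N 31 m'"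
      if "m' 0 = int p" "m' 2 = 1" "m' 10 = int A" "m' 11 = int (Suc x)" "m' 12 = int (A\<^sup>2)" "m' 15 = 0" for m'
      unfolding N_def using Suc.hyps(2) x that by (intro Suc.hyps(1) b') auto
    show ?thesis
    proof (cases "int A - int x * int x < 0")
      case c1: True
      show ?thesis unfolding count
        using m s K fg c1 c[OF c1] True by (simp add: exec_simps IH)
    next
      case c1: False
      \<comment> \<open>When the first test fails, the second is jumped over and the round takes
        only 10 instructions; monotonicity restores the uniform count.\<close>
      have "halts_in decision_prog f g (cost_bound K) b (10 + N) 31 m"
        using m s K fg c1 True by (simp add: exec_simps IH)
      then show ?thesis unfolding count by (rule halts_in_mono) simp
    qed
  next
    case False
    then have "\<not> b" using b x by blast
    then show ?thesis unfolding count
      using m s K fg c False by (cases "int A - int x * int x < 0") (simp_all add: exec_simps)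
  qed
qed

section \<open>The loss factor, the number of queries and the whole run\<close>

text \<open>The exponent in the threshold of \<open>agreeing_powers_imp_eq\<close>, as a function of
  the bit length of \<open>p\<close>. For positive \<open>L\<close> the choice of \<open>j\<close>
  puts \<open>2 ^ j\<close> between \<open>sqrt L\<close> and \<open>2 * sqrt L\<close>, which makes
  both main summands \<open>o(L)\<close>.\<close>

definition slack_exponent :: "nat \<Rightarrow> nat" where
  "slack_exponent L = (let j = floorlog 4 L in (2 * j + 2) * 2 ^ j + 4 * L div j + 6)"

text \<open>The first point at which both hypotheses on \<open>h\<close> in
  \<open>agreeing_powers_imp_eq\<close> hold, and so the point where the query loop accepts if no
  answers differ.\<close>

definition query_bound :: "nat \<Rightarrow> nat \<Rightarrow> nat" where
  "query_bound A p = (LEAST h. A < h\<^sup>2 \<and> A\<^sup>2 < h * p)"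

lemma query_bound_exists: "0 < p \<Longrightarrow> A < (A\<^sup>2 + 1)\<^sup>2 \<and> A\<^sup>2 < (A\<^sup>2 + 1) * (p::nat)"
  using le_square[of A] by (cases p) (auto simp: power2_eq_square less_Suc_eq_le intro: trans_le_add1)

lemma query_bound_iff:
  assumes "0 < p" "y \<le> query_bound A p"
  shows "A < y\<^sup>2 \<and> A\<^sup>2 < y * p \<longleftrightarrow> y = query_bound A p"
proof -
  have "A < (query_bound A p)\<^sup>2 \<and> A\<^sup>2 < query_bound A p * p"
    unfolding query_bound_def by (rule LeastI, rule query_bound_exists[OF assms(1)])
  moreover have "\<not> (A < y\<^sup>2 \<and> A\<^sup>2 < y * p)" if "y < query_bound A p"
    using that unfolding query_bound_def by (rule not_less_Least)
  ultimately show ?thesis using assms(2) by (cases "y = query_bound A p") auto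
qed

text \<open>A crude estimate that serves only to bound the register sizes.\<close>

lemma query_bound_le:
  assumes "0 < p"
  shows "query_bound A p \<le> A\<^sup>2 + 1"
  unfolding query_bound_def by (intro Least_le query_bound_exists assms)

text \<open>By minimality the predecessor violates one of the two inequalities, so it is at most
  \<open>sqrt A\<close> or at most \<open>A^2 / p\<close>. This is the source of the two terms in
  the running time.\<close>

lemma query_bound_le_real:
  assumes "0 < p"
  shows "real (query_bound A p) \<le> 1 + sqrt (real A) + (real A)\<^sup>2 / real p"
proof (cases "query_bound A p")
  case (Suc h)
  then have "\<not> (A < h\<^sup>2 \<and> A\<^sup>2 < h * p)" using query_bound_iff[OF assms, of h A] by simp
  then consider "h\<^sup>2 \<le> A" | "h * p \<le> A\<^sup>2" by linarith
  then have "real h \<le> sqrt (real A) + (real A)\<^sup>2 / real p"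
  proof cases
    case 1
    then have "real h \<le> sqrt (real A)" by (metis of_nat_le_iff of_nat_power real_le_rsqrt)
    then show ?thesis by (simp add: add_increasing2)
  next
    case 2
    then have "real h * real p \<le> (real A)\<^sup>2" by (metis of_nat_le_iff of_nat_mult of_nat_power)
    then have "real h \<le> (real A)\<^sup>2 / real p" using assms by (simp add: field_simps)
    then show ?thesis by (simp add: add_increasing)
  qed
  then show ?thesis using Suc by simp
qed simp

text \<open>The segments are verified from the last to the first, each providing the continuation
  for the one before. The largest quantity to accommodate is
  \<open>h^2 \<le> 2 ^ (4 * M + 4 * L)\<close>, which dictates \<open>K\<close>.\<close>

lemma decision_prog_halts:
  fixes p e L j M A K h :: nat
  assumes p: "2 < p" and e: "0 < e" "e < p"
  defines "L \<equiv> floorlog 2 p" and "j \<equiv> floorlog 4 L" and "M \<equiv> slack_exponent L"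
  defines "A \<equiv> 2 ^ M * e" and "h \<equiv> query_bound (2 ^ M * e) p" and "K \<equiv> 4 * M + 4 * L + 10"
  assumes fg: "\<And>y. small K (f y)" "\<And>y. small K (g y)"
    and b: "b \<longleftrightarrow> (\<forall>y < h. f (int y) = g (int y))"
  shows "halts_in decision_prog f g (cost_bound K) b (32 + 5 * L + 7 * j + 4 * M + 12 * h) 0 (init_mem p e)"
proof -
  have Lb: "2 ^ (L - 1) \<le> p" "p < 2 ^ L" using floorlog_bounds[of p 2] p by (auto simp: L_def)
  have L0: "0 < L" using Lb(2) p by (cases L) auto
  have jb: "4 ^ (j - 1) \<le> L" "L < 4 ^ j" using floorlog_bounds[of L 4] L0 by (auto simp: j_def)
  have j0: "0 < j" using jb(2) L0 by (cases j) auto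
  have M: "M = (2 * j + 2) * 2 ^ j + 4 * L div j + 6" by (simp add: M_def slack_exponent_def j_def Let_def)
  have sm: "small K (int y)" if "y < 2 ^ K" for y
    using that by (simp add: small_def)
  have A: "A < 2 ^ (M + L)"
    unfolding A_def power_add using e Lb(2) by (intro mult_less_mono2) auto
  have A2: "A\<^sup>2 < 2 ^ (2 * M + 2 * L)"
  proof -
    have "A\<^sup>2 < (2 ^ (M + L))\<^sup>2" using A by (intro power_strict_mono) auto
    then show ?thesis by (simp add: distrib_left mult.commute flip: power_mult)
  qed
  have h: "h \<le> 2 ^ (2 * M + 2 * L)"
    using query_bound_le[of p A] p A2 by (simp add: h_def A_def)
  have up: "y < 2 ^ K" if "y \<le> 2 ^ i" "i < K" for y i :: nat
    using that(1) power_strict_increasing[OF that(2), of "2::nat"] by linarith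
  have h2: "h\<^sup>2 < 2 ^ K"
  proof (rule up)
    have "h\<^sup>2 \<le> (2 ^ (2 * M + 2 * L))\<^sup>2" using h by (intro power_mono) auto
    then show "h\<^sup>2 \<le> 2 ^ (4 * M + 4 * L)" by (simp add: power2_eq_square flip: power_add)
  qed (simp add: K_def)
  have hp: "h * p < 2 ^ K"
  proof (rule up)
    have "h * p \<le> 2 ^ (2 * M + 2 * L) * 2 ^ L" using h Lb(2) by (intro mult_le_mono) auto
    then show "h * p \<le> 2 ^ (3 * L + 2 * M)" by (simp flip: power_add)
  qed (simp add: K_def)
  have sA: "small K (int (A\<^sup>2))" "small K (int (h\<^sup>2))" "small K (int (h * p))" "small K (int p)"
    "small K (int A)" "small K (int e)"
    by (intro sm up[of _ "2 * M + 2 * L"] up[of _ L] up[of _ "M + L"] h2 hp;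
        use A A2 Lb(2) e in \<open>simp add: K_def\<close>)+
  \<comment> \<open>Step counts from each loop entry to the end, written in the exact shape that the
    loop lemmas produce.\<close>
  define N5 where "N5 = 12 + (0 + 12 * (h - 0))"
  define N3 where "N3 = 1 + (Suc N5 + 4 * M)"
  define N2 where "N2 = 2 + ((10 + N3) + 7 * (j - 0))"
  define N1 where "N1 = 2 + ((2 + N2) + 5 * (L - 0))"
  have S31: "halts_in decision_prog f g (cost_bound K) b N5 31 m"
    if "m 0 = int p" "m 2 = 1" "m 10 = int A" "m 11 = 0" "m 12 = int (A\<^sup>2)" "m 15 = 0" for m
    unfolding N5_def using that b p
    by (intro loop_query[where A=A and p=p] sA fg) (auto simp: h_def A_def query_bound_iff)
  have S30: "halts_in decision_prog f g (cost_bound K) b (Suc N5) 30 m"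
    if "m 0 = int p" "m 2 = 1" "m 10 = int A" "m 11 = 0" "m 15 = 0" for m
    using that sA by (simp add: exec_simps S31 power2_eq_square)
  have S26: "halts_in decision_prog f g (cost_bound K) b N3 26 m"
    if "m 0 = int p" "m 2 = 1" "m 9 = int M" "m 10 = int e" "m 11 = 0" "m 15 = 0" for m
    unfolding N3_def
  proof (rule loop_double[where a="int e"])
    show "small K (2 ^ M * int e)" using sA(5) by (simp add: A_def)
    show "small K (int M)" using less_exp[of M] by (intro sm up[of _ M]) (auto simp: K_def)
    show "0 < int e" using e by simp
    show "halts_in decision_prog f g (cost_bound K) b (Suc N5) 30 m'"
      if "\<forall>r. r \<notin> {9, 10} \<longrightarrow> m' r = m r" "m' 10 = 2 ^ M * int e" for m'
      using that \<open>m 0 = int p\<close> \<open>m 2 = 1\<close> \<open>m 11 = 0\<close> \<open>m 15 = 0\<close> by (intro S30) (auto simp: A_def)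
  qed (use that in auto)
  have iM: "int M = (2 * int j + 2) * 2 ^ j + 4 * int L div int j + 6"
    using M by (simp add: zdiv_int algebra_simps)
  have sM: "small K (int M)" and sL: "small K (4 * int L)"
    using sm[OF up, of M M] sm[OF up, of "4 * L" "4 * L"] less_exp[of M] less_exp[of "4 * L"]
    by (simp_all add: K_def)
  have s16: "small K (int j)" "small K 1" "small K (int j + 1)" "small K (2 * int j + 2)" "small K (2 ^ j)"
    "small K ((2 * int j + 2) * 2 ^ j)" "small K (4 * int L div int j)" "small K 6"
    "small K ((2 * int j + 2) * 2 ^ j + 4 * int L div int j)"
  proof -
    define T where "T = (2 * int j + 2) * 2 ^ j"
    define W where "W = 4 * int L div int j"
    have "(2 * int j + 2) * 1 \<le> T" "1 * 2 ^ j \<le> T"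
      unfolding T_def by (intro mult_left_mono mult_right_mono; simp)+
    then have T: "2 * int j + 2 \<le> T" "2 ^ j \<le> T" by simp_all
    have W: "0 \<le> W" using j0 by (simp add: W_def pos_imp_zdiv_nonneg_iff)
    have MTW: "int M = T + W + 6" unfolding iM T_def W_def ..
    show "small K (int j)" "small K 1" "small K (int j + 1)" "small K (2 * int j + 2)" "small K (2 ^ j)"
      "small K ((2 * int j + 2) * 2 ^ j)" "small K (4 * int L div int j)" "small K 6"
      "small K ((2 * int j + 2) * 2 ^ j + 4 * int L div int j)"
      unfolding T_def[symmetric] W_def[symmetric]
      by (rule small_le[OF sM]; use T W MTW in simp)+
  qed
  have sL': "small K (int L)" "small K (2 * int L)" "small K 0"
    by (rule small_le[OF sL]; simp)+
  have S16: "halts_in decision_prog f g (cost_bound K) b (10 + N3) 16 m"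
    if "m 0 = int p" "m 1 = int e" "m 2 = 1" "m 3 = int L" "m 6 = int j" "m 8 = 2 ^ j" "m 11 = 0" "m 15 = 0" for m
    using that s16 sL sL' sA by (simp add: exec_simps S26 iM)
  have S9: "halts_in decision_prog f g (cost_bound K) b N2 9 m"
    if m: "m 0 = int p" "m 1 = int e" "m 2 = 1" "m 3 = int L" "m 6 = 0" "m 7 = 1" "m 8 = 1" "m 11 = 0" "m 15 = 0" for m
    unfolding N2_def
  proof (rule loop_quarter_bits[OF jb])
    have "(4::nat) ^ j = 4 * 4 ^ (j - 1)" using j0 by (cases j) auto
    then have "4 ^ j \<le> 4 * L" using jb(1) by simp
    then have "4 ^ j \<le> 4 * int L" by (metis of_nat_le_iff of_nat_mult of_nat_numeral of_nat_power)
    then show "small K (4 ^ j)" by (intro small_le[OF sL]) auto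
    show "halts_in decision_prog f g (cost_bound K) b (10 + N3) 16 m'"
      if "\<forall>r. r \<notin> {5, 6, 7, 8} \<longrightarrow> m' r = m r" "m' 6 = int j" "m' 8 = 2 ^ j" for m'
      using that m by (intro S16) auto
  qed (use m in auto)
  have S7: "halts_in decision_prog f g (cost_bound K) b (2 + N2) 7 m"
    if "m 0 = int p" "m 1 = int e" "m 2 = 1" "m 3 = int L" "m 6 = 0" "m 11 = 0" "m 15 = 0" for m
    using that s16 by (simp add: exec_simps S9)
  have S2: "halts_in decision_prog f g (cost_bound K) b N1 2 m"
    if m: "m 0 = int p" "m 1 = int e" "m 2 = 1" "m 3 = 0" "m 4 = 1" "m 6 = 0" "m 11 = 0" "m 15 = 0" for m
    unfolding N1_def
  proof (rule loop_bits[OF Lb])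
    show "small K (2 ^ L)" using sm[of "2 ^ L"] by (simp add: K_def)
    show "halts_in decision_prog f g (cost_bound K) b (2 + N2) 7 m'"
      if "\<forall>r. r \<notin> {3, 4, 5} \<longrightarrow> m' r = m r" "m' 3 = int L" for m'
      using that m by (intro S7) auto
  qed (use m in auto)
  have "halts_in decision_prog f g (cost_bound K) b (2 + N1) 0 (init_mem p e)"
    using s16 by (simp add: exec_simps S2 init_mem_def flip: numeral_2_eq_2)
  moreover have "2 + N1 = 32 + 5 * L + 7 * j + 4 * M + 12 * h"
    by (simp add: N1_def N2_def N3_def N5_def)
  ultimately show ?thesis by (simp only:)
qed

section \<open>Running time\<close>

text \<open>Collects everything in the running time apart from the maximum of \<open>sqrt e\<close>
  and \<open>e^2 / p\<close>. With \<open>12 * h \<le> 12 + 24 * 4 ^ M * R\<close>, the 44 is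
  \<open>32 + 12\<close>, and \<open>4 ^ M\<close> comes from squaring the threshold.\<close>

definition time_factor :: "nat \<Rightarrow> real" where
  "time_factor L = 2 * real (cost_bound (4 * slack_exponent L + 4 * L + 10)) *
     (44 + 5 * real L + 7 * real (floorlog 4 L) + 4 * real (slack_exponent L) + 24) * 4 ^ slack_exponent L"

lemma floorlog_at_top: "1 < b \<Longrightarrow> filterlim (\<lambda>n. floorlog b n) at_top at_top"
  unfolding filterlim_at_top_ge[where c=1]
proof safe
  fix Z :: nat assume "1 < b" "1 \<le> Z"
  show "\<forall>\<^sub>F n in sequentially. Z \<le> floorlog b n"
    using eventually_ge_at_top[of "b ^ Z"]
  proof eventually_elim
    case (elim n)
    have "b ^ (Z - 1) \<le> b ^ Z" using \<open>1 < b\<close> by (intro power_increasing) auto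
    then show ?case using elim \<open>1 < b\<close> by (intro floorlog_geI) linarith+
  qed
qed

text \<open>From \<open>4 ^ (j - 1) \<le> L < 4 ^ j\<close>, \<open>j\<close> lies between
  \<open>log 4 L\<close> and \<open>log 4 L + 1\<close>, and
  \<open>2 ^ j \<le> 2 * sqrt L\<close>.\<close>

lemma slack_exponent_le:
  assumes "1 < L"
  shows "real (slack_exponent L) \<le> (2 * (log 4 L + 1) + 2) * (2 * sqrt L) + 4 * real L / log 4 L + 6"
proof -
  define j where "j = floorlog 4 L"
  have jb: "4 ^ (j - 1) \<le> L" "L < 4 ^ j" using floorlog_bounds[of L 4] assms by (auto simp: j_def)
  have j0: "0 < j" using jb(2) assms by (cases j) auto
  have l0: "0 < log 4 (real L)" using assms by simp
  have jr: "4 ^ (j - 1) \<le> real L" "real L < 4 ^ j"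
  proof -
    have "real (4 ^ (j - 1)) \<le> real L" "real L < real (4 ^ j)" using jb by (simp_all only: of_nat_le_iff of_nat_less_iff)
    then show "4 ^ (j - 1) \<le> real L" "real L < 4 ^ j" by simp_all
  qed
  have "4 powr (real (j - 1)) \<le> real L" using jr(1) by (simp only: powr_realpow)
  then have "real (j - 1) \<le> log 4 (real L)" using assms by (simp add: le_log_iff)
  then have j1: "real j \<le> log 4 (real L) + 1" using j0 by simp
  have "real L < 4 powr real j" using jr(2) by (simp add: powr_realpow)
  then have j2: "log 4 (real L) \<le> real j" using assms by (simp add: log_le_iff)
  have "(2 ^ j)\<^sup>2 = (4::real) ^ j" by (simp add: power2_eq_square flip: power_mult_distrib)
  also have "\<dots> = 4 * 4 ^ (j - 1)" using j0 by (cases j) auto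
  also have "\<dots> \<le> 4 * real L" using jr(1) by simp
  finally have "2 ^ j \<le> sqrt (4 * real L)" by (rule real_le_rsqrt)
  then have j3: "2 ^ j \<le> 2 * sqrt (real L)" by (simp add: real_sqrt_mult)
  have "real (4 * L div j) \<le> real (4 * L) / real j" by (rule of_nat_div_le_of_nat)
  also have "\<dots> \<le> real (4 * L) / log 4 (real L)" using j2 l0 by (intro divide_left_mono) auto
  finally have d: "real (4 * L div j) \<le> 4 * real L / log 4 (real L)" by simp
  have "real (slack_exponent L) = (2 * real j + 2) * 2 ^ j + real (4 * L div j) + 6"
    by (simp add: slack_exponent_def Let_def j_def algebra_simps)
  also have "\<dots> \<le> (2 * (log 4 L + 1) + 2) * (2 * sqrt L) + 4 * real L / log 4 L + 6"
    using j1 j3 d l0 by (intro add_mono mult_mono) auto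
  finally show ?thesis .
qed

lemma slack_exponent_div_tendsto_0: "(\<lambda>L. real (slack_exponent L) / real L) \<longlonglongrightarrow> 0"
proof (rule tendsto_sandwich[OF _ _ tendsto_const])
  show "(\<lambda>L. ((2 * (log 4 (real L) + 1) + 2) * (2 * sqrt (real L)) + 4 * real L / log 4 (real L) + 6) / real L)
      \<longlonglongrightarrow> 0"
    by real_asymp
  show "\<forall>\<^sub>F L in sequentially. real (slack_exponent L) / real L \<le>
      ((2 * (log 4 (real L) + 1) + 2) * (2 * sqrt (real L)) + 4 * real L / log 4 (real L) + 6) / real L"
    using eventually_gt_at_top[of 1] by eventually_elim (intro divide_right_mono slack_exponent_le, auto)
qed auto

lemma time_factor_pos: "0 < time_factor L"
  using one_le_cost_bound[of "4 * slack_exponent L + 4 * L + 10"] by (simp add: time_factor_def add_pos_nonneg)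

text \<open>Eventually \<open>slack_exponent L \<le> L\<close>, so all factors but the last are
  polynomial in \<open>L\<close>; the last contributes \<open>slack_exponent L * ln 4\<close>, which
  is \<open>o(L)\<close>.\<close>

lemma ln_growth_div_tendsto_0: "(\<lambda>L. ln (time_factor L) / real L) \<longlonglongrightarrow> 0"
proof (rule tendsto_sandwich[OF _ _ tendsto_const])
  have "\<forall>\<^sub>F L in sequentially. real (slack_exponent L) / real L < 1"
    using order_tendstoD(2)[OF slack_exponent_div_tendsto_0] by simp
  then have M: "\<forall>\<^sub>F L in sequentially. slack_exponent L \<le> L"
    using eventually_gt_at_top[of 0] by eventually_elim auto
  show "\<forall>\<^sub>F L in sequentially. ln (time_factor L) / real L \<le>
      ln (2 * (8 * real L + 12)\<^sup>2 * (16 * real L + 80)) / real L + ln 4 * (real (slack_exponent L) / real L)"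
    using M eventually_gt_at_top[of 0]
  proof eventually_elim
    case (elim L)
    have "L < 4 ^ L" by (rule less_le_trans[OF less_exp]) (simp add: power_mono)
    then have j: "floorlog 4 L \<le> L" by (intro floorlog_leI) auto
    have "cost_bound (4 * slack_exponent L + 4 * L + 10) \<le> (8 * L + 12)\<^sup>2"
      unfolding cost_bound_def using elim by (intro power_mono) auto
    then have "real (cost_bound (4 * slack_exponent L + 4 * L + 10)) \<le> real ((8 * L + 12)\<^sup>2)"
      by (simp only: of_nat_le_iff)
    then have c: "real (cost_bound (4 * slack_exponent L + 4 * L + 10)) \<le> (8 * real L + 12)\<^sup>2" by simp
    have "time_factor L \<le> 2 * (8 * real L + 12)\<^sup>2 * (16 * real L + 80) * 4 ^ slack_exponent L"
      unfolding time_factor_def using c j elim by (intro mult_right_mono mult_mono) auto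
    then have "ln (time_factor L) \<le> ln (2 * (8 * real L + 12)\<^sup>2 * (16 * real L + 80) * 4 ^ slack_exponent L)"
      using time_factor_pos[of L] by (intro ln_mono) auto
    also have "\<dots> = ln (2 * (8 * real L + 12)\<^sup>2 * (16 * real L + 80)) + real (slack_exponent L) * ln 4"
      by (subst ln_mult) (auto simp: ln_realpow add_pos_nonneg)
    finally have "ln (time_factor L) / real L \<le>
        (ln (2 * (8 * real L + 12)\<^sup>2 * (16 * real L + 80)) + real (slack_exponent L) * ln 4) / real L"
      by (rule divide_right_mono) simp
    then show ?case by (simp add: add_divide_distrib mult.commute)
  qed
  have "(\<lambda>L. ln (2 * (8 * real L + 12)\<^sup>2 * (16 * real L + 80)) / real L) \<longlonglongrightarrow> 0"
    by real_asymp
  from tendsto_add[OF this tendsto_mult_right_zero[OF slack_exponent_div_tendsto_0, of "ln 4"]]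
  show "(\<lambda>L. ln (2 * (8 * real L + 12)\<^sup>2 * (16 * real L + 80)) / real L + ln 4 * (real (slack_exponent L) / real L)) \<longlonglongrightarrow> 0"
    by simp
  have "1 \<le> time_factor L" for L
  proof -
    have "1 \<le> real (cost_bound (4 * slack_exponent L + 4 * L + 10))" using one_le_cost_bound by simp
    then have "2 * 1 * (24 :: real) * 1 \<le> time_factor L"
      unfolding time_factor_def by (intro mult_mono) auto
    then show ?thesis by simp
  qed
  then show "\<forall>\<^sub>F L in sequentially. 0 \<le> ln (time_factor L) / real L" by simp
qed

text \<open>The solution of \<open>p powr \<epsilon> = time_factor L\<close>, so that the loss is
  absorbed exactly into the power of \<open>p\<close>.\<close>

definition time_exponent :: "nat \<Rightarrow> real" where
  "time_exponent p = ln (time_factor (floorlog 2 p)) / ln (real p)"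

lemma time_exponent_tendsto_0: "time_exponent \<longlonglongrightarrow> 0"
proof -
  have lim: "(\<lambda>p. ln (time_factor (floorlog 2 p)) / real (floorlog 2 p)) \<longlonglongrightarrow> 0"
    by (rule filterlim_compose[OF ln_growth_div_tendsto_0 floorlog_at_top]) simp
  show ?thesis
  proof (rule Lim_null_comparison[OF _ tendsto_mult_right_zero[OF tendsto_norm_zero[OF lim], of "2 / ln 2"]])
    show "\<forall>\<^sub>F p in sequentially. norm (time_exponent p) \<le>
        2 / ln 2 * norm (ln (time_factor (floorlog 2 p)) / real (floorlog 2 p))"
      using eventually_ge_at_top[of 2]
    proof eventually_elim
      case (elim p)
      define L where "L = floorlog 2 p"
      have L: "2 ^ (L - 1) \<le> p" using floorlog_bounds[of p 2] elim by (auto simp: L_def)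
      have L2: "2 \<le> L" using floorlog_geI[of 2 2 p] elim by (simp add: L_def)
      \<comment> \<open>\<open>L\<close> and \<open>ln p\<close> are of the same order:
        \<open>L - 1 \<ge> L / 2\<close> for \<open>L \<ge> 2\<close>, and
        \<open>2 ^ (L - 1) \<le> p\<close>.\<close>
      have "real L / 2 * ln 2 \<le> real (L - 1) * ln 2" using L2 by (intro mult_right_mono) auto
      also have "\<dots> = ln (2 ^ (L - 1))" by (simp add: ln_realpow)
      also have "\<dots> = ln (real (2 ^ (L - 1)))" by simp
      also have "\<dots> \<le> ln (real p)"
        using L elim by (intro ln_mono) (simp_all only: of_nat_le_iff of_nat_0_less_iff zero_less_power zero_less_numeral)
      finally have "real L / 2 * ln 2 \<le> ln (real p)" .
      then have "\<bar>ln (time_factor L)\<bar> / ln (real p) \<le> \<bar>ln (time_factor L)\<bar> / (real L / 2 * ln 2)"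
        using L2 elim by (intro divide_left_mono) auto
      then show ?case using elim by (simp add: time_exponent_def L_def[symmetric] abs_divide field_simps)
    qed
  qed
qed

lemma powr_exponent_error:
  assumes "2 \<le> p"
  shows "real p powr time_exponent p = time_factor (floorlog 2 p)"
  using assms time_factor_pos[of "floorlog 2 p"] by (simp add: time_exponent_def powr_def)

theorem theorem3p12:
  shows "\<exists>(P :: instr list) (\<epsilon> :: nat \<Rightarrow> real). \<epsilon> \<longlonglongrightarrow> 0 \<and>
    (\<forall>p e s t :: nat. prime p \<and> 0 < e \<and> e dvd (p - 1) \<and> e \<le> (p - 1) div 2 \<and> s < p \<and> t < p \<longrightarrow>
      outputs_within P (power_box p e s) (power_box p e t) (init_mem p e) (s = t)
        (max (sqrt (real e) * real p powr \<epsilon> p) ((real e)^2 * real p powr (-1 + \<epsilon> p))))"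
proof (intro exI[of _ decision_prog] exI[of _ time_exponent] conjI allI impI time_exponent_tendsto_0)
  fix p e s t :: nat
  assume asm: "prime p \<and> 0 < e \<and> e dvd (p - 1) \<and> e \<le> (p - 1) div 2 \<and> s < p \<and> t < p"
  define L where "L = floorlog 2 p"
  define j where "j = floorlog 4 L"
  define M where "M = slack_exponent L"
  define K where "K = 4 * M + 4 * L + 10"
  define h where "h = query_bound (2 ^ M * e) p"
  define R where "R = max (sqrt (real e)) ((real e)\<^sup>2 / real p)"
  \<comment> \<open>A positive \<open>e\<close> with \<open>e \<le> (p - 1) div 2\<close> excludes
    \<open>p = 2\<close> and gives \<open>e < p\<close>.\<close>
  have pr: "prime p" and e: "0 < e" "e < p" and st: "s < p" "t < p" and p2: "2 < p"
    using asm by auto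
  have Lb: "p < 2 ^ L" using floorlog_bounds[of p 2] p2 by (auto simp: L_def)
  have L0: "0 < L" using Lb p2 by (cases L) auto
  have jb: "L < 4 ^ j" using floorlog_bounds[of L 4] L0 by (auto simp: j_def)
  have j0: "0 < j" using jb L0 by (cases j) auto
  have M: "M = (2 * j + 2) * 2 ^ j + 4 * L div j + 6" by (simp add: M_def slack_exponent_def j_def Let_def)
  have pK: "int p < 2 ^ K"
  proof -
    have "(2::nat) ^ L \<le> 2 ^ K" by (rule power_increasing) (auto simp: K_def)
    then have "p < 2 ^ K" using Lb by linarith
    then show ?thesis by simp
  qed
  have small: "small K (power_box p e u y)" for u y
    using pK p2 by (auto simp: small_def power_box_def intro: less_trans[OF pos_mod_bound])
  have box: "power_box p e s (int x) = power_box p e t (int x) \<longleftrightarrow> [(x + s) ^ e = (x + t) ^ e] (mod p)" for x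
    by (simp add: power_box_def Cong.cong_def flip: of_nat_add of_nat_power of_nat_mod)
  have query_bound: "2 ^ M * e < h\<^sup>2" "(2 ^ M * e)\<^sup>2 < h * p"
    using query_bound_iff[of p h "2 ^ M * e"] p2 by (auto simp: h_def)
  have b: "s = t \<longleftrightarrow> (\<forall>x < h. power_box p e s (int x) = power_box p e t (int x))"
    unfolding box
    using agreeing_powers_imp_eq[OF pr p2 Lb j0 jb e(1) st, of h] query_bound unfolding M by auto
  have "halts_in decision_prog (power_box p e s) (power_box p e t) (cost_bound K) (s = t)
      (32 + 5 * L + 7 * j + 4 * M + 12 * h) 0 (init_mem p e)"
    unfolding K_def M_def j_def h_def L_def
    by (rule decision_prog_halts[OF p2 e]) (use small b in \<open>simp_all add: K_def M_def j_def h_def L_def\<close>)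
  then obtain k c where run: "exec decision_prog (power_box p e s) (power_box p e t) k (Running 0 (init_mem p e)) 0
      = (Halted (s = t), c)" and c: "c \<le> cost_bound K * (32 + 5 * L + 7 * j + 4 * M + 12 * h)"
    using halts_in_exec[of decision_prog _ _ _ _ _ 0 _ 0] by fastforce
  have R1: "1 \<le> R" using e by (simp add: R_def le_max_iff_disj)
  have "real h \<le> 1 + sqrt (2 ^ M * real e) + (2 ^ M * real e)\<^sup>2 / real p"
    using query_bound_le_real[of p "2 ^ M * e"] p2 by (simp add: h_def)
  \<comment> \<open>Bounding \<open>sqrt (2 ^ M)\<close> by \<open>4 ^ M\<close> is wasteful, but it
    lets both terms share one factor, which is still a \<open>p\<close> power with exponent tending
    to 0.\<close>
  also have "sqrt (2 ^ M * real e) \<le> 4 ^ M * R"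
  proof -
    have "sqrt (2 ^ M) \<le> sqrt ((2 ^ M)\<^sup>2)"
      by (intro real_sqrt_le_mono) (simp add: power2_eq_square)
    also have "\<dots> \<le> 4 ^ M" by (simp add: power_mono)
    finally show ?thesis unfolding real_sqrt_mult by (intro mult_mono) (auto simp: R_def)
  qed
  also have "(2 ^ M * real e)\<^sup>2 / real p \<le> 4 ^ M * R"
  proof -
    have "(2 ^ M * real e)\<^sup>2 / real p = 4 ^ M * ((real e)\<^sup>2 / real p)"
      by (simp add: power_mult_distrib power2_eq_square flip: power_mult_distrib)
    also have "\<dots> \<le> 4 ^ M * R" by (intro mult_left_mono) (auto simp: R_def)
    finally show ?thesis .
  qed
  finally have h: "real h \<le> 1 + 2 * (4 ^ M * R)" by linarith
  \<comment> \<open>Since \<open>4 ^ M * R \<ge> 1\<close>, the instructions outside the query loop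
    can be multiplied by it too, so that it factors out of the whole cost.\<close>
  have "1 * 1 \<le> 4 ^ M * R" using R1 by (intro mult_mono) auto
  then have MR: "1 \<le> 4 ^ M * R" by simp
  have "real c \<le> real (cost_bound K * (32 + 5 * L + 7 * j + 4 * M + 12 * h))"
    using c by (simp only: of_nat_le_iff)
  also have "\<dots> = real (cost_bound K) * (32 + 5 * real L + 7 * real j + 4 * real M + 12 * real h)"
    by simp
  also have "\<dots> \<le> real (cost_bound K) * ((44 + 5 * real L + 7 * real j + 4 * real M + 24) * (4 ^ M * R))"
  proof (rule mult_left_mono)
    have "32 + 5 * real L + 7 * real j + 4 * real M + 12 * real h
        \<le> (44 + 5 * real L + 7 * real j + 4 * real M) * 1 + 24 * (4 ^ M * R)" using h by simp
    also have "\<dots> \<le> (44 + 5 * real L + 7 * real j + 4 * real M) * (4 ^ M * R) + 24 * (4 ^ M * R)"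
      using MR by (intro add_right_mono mult_left_mono) auto
    finally show "32 + 5 * real L + 7 * real j + 4 * real M + 12 * real h
        \<le> (44 + 5 * real L + 7 * real j + 4 * real M + 24) * (4 ^ M * R)" by (simp add: algebra_simps)
  qed simp
  also have "\<dots> = time_factor L / 2 * R"
    by (simp add: time_factor_def K_def M_def j_def)
  also have "\<dots> \<le> time_factor L * R"
    using time_factor_pos[of L] R1 by (intro mult_right_mono) auto
  also have "\<dots> = max (sqrt (real e) * time_factor L) ((real e)\<^sup>2 / real p * time_factor L)"
    unfolding R_def using time_factor_pos[of L] by (simp add: max_mult_distrib_left mult.commute)
  also have "time_factor L = real p powr time_exponent p"
    using powr_exponent_error[of p] p2 by (simp add: L_def)
  also have "(real e)\<^sup>2 / real p * real p powr time_exponent p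
      = (real e)\<^sup>2 * real p powr (-1 + time_exponent p)"
    using p2 by (simp add: powr_add powr_minus_divide powr_diff)
  finally show "outputs_within decision_prog (power_box p e s) (power_box p e t) (init_mem p e) (s = t)
        (max (sqrt (real e) * real p powr time_exponent p) ((real e)^2 * real p powr (-1 + time_exponent p)))"
    unfolding outputs_within_def using run by blast
qed

end
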